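(* Let $p$ be a prime with $p\equiv 3 \pmod{4}$, and let $S_2=\{a+bi\in\mathbb{Z}_p[i] : a^2+b^2\equiv 1 \pmod p\}$ be the set of units of $\mathbb{Z}_p[i]$. Then the Cayley graph $\mathcal{G}_p=\mathrm{Cay}(\mathbb{Z}_p[i],S_2)$ is a $(p+1)$-regular Ramanujan graph.
   Context: $\mathbb{Z}_n[i]=\{a+bi: a,b\in\mathbb{Z}_n\}$ with $i^2=-1$ is the ring of Gaussian integers modulo $n$, regarded as an additive group. The norm of $a+bi\in\mathbb{Z}_n[i]$ is $a^2+b^2 \bmod n$; a unit here means an element of norm $1$. For an additive group $\Gamma$ and a symmetric subset $S=-S$ not containing $0$, $\mathrm{Cay}(\Gamma,S)$ is the graph with vertex set $\Gamma$ in which $u\sim v$ iff $v-u\in S$. A finite, connected, $k$-regular graph is Ramanujan if every adjacency eigenvalue $\lambda\neq\pm k$ satisfies $|\lambda|\le 2\sqrt{k-1}$. *)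

theory Defs
  imports Complex_Main "HOL-Computational_Algebra.Primes"
begin

text \<open>Finite simple graphs given by a vertex set V and an adjacency relation E
  (only its restriction to V matters).\<close>

definition nbrs :: "'a set \<Rightarrow> ('a \<Rightarrow> 'a \<Rightarrow> bool) \<Rightarrow> 'a \<Rightarrow> 'a set" where
  "nbrs V E v = {u \<in> V. E v u}"

definition regular_graph :: "'a set \<Rightarrow> ('a \<Rightarrow> 'a \<Rightarrow> bool) \<Rightarrow> nat \<Rightarrow> bool" where
  "regular_graph V E k \<longleftrightarrow> (\<forall>v\<in>V. card (nbrs V E v) = k)"

definition connected_graph :: "'a set \<Rightarrow> ('a \<Rightarrow> 'a \<Rightarrow> bool) \<Rightarrow> bool" where
  "connected_graph V E \<longleftrightarrow> V \<noteq> {} \<and>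
     (\<forall>u\<in>V. \<forall>v\<in>V. (\<lambda>x y. x \<in> V \<and> y \<in> V \<and> E x y)\<^sup>*\<^sup>* u v)"

definition adj_eigenvalue :: "'a set \<Rightarrow> ('a \<Rightarrow> 'a \<Rightarrow> bool) \<Rightarrow> complex \<Rightarrow> bool" where
  "adj_eigenvalue V E mu \<longleftrightarrow>
     (\<exists>f :: 'a \<Rightarrow> complex. (\<exists>v\<in>V. f v \<noteq> 0) \<and>
        (\<forall>v\<in>V. (\<Sum>u\<in>nbrs V E v. f u) = mu * f v))"

definition ramanujan :: "'a set \<Rightarrow> ('a \<Rightarrow> 'a \<Rightarrow> bool) \<Rightarrow> nat \<Rightarrow> bool" where
  "ramanujan V E k \<longleftrightarrow> finite V \<and> connected_graph V E \<and> regular_graph V E k \<and>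
     (\<forall>mu. adj_eigenvalue V E mu \<and> mu \<noteq> of_nat k \<and> mu \<noteq> - of_nat k
          \<longrightarrow> cmod mu \<le> 2 * sqrt (real k - 1))"

text \<open>Z_n[i] represented as pairs (a,b) with 0 \<le> a,b < n, standing for a+bi.\<close>
definition gi_carrier :: "int \<Rightarrow> (int \<times> int) set" where
  "gi_carrier n = {0..<n} \<times> {0..<n}"

definition gi_diff :: "int \<Rightarrow> int \<times> int \<Rightarrow> int \<times> int \<Rightarrow> int \<times> int" where
  "gi_diff n z w = ((fst z - fst w) mod n, (snd z - snd w) mod n)"

definition gi_norm :: "int \<Rightarrow> int \<times> int \<Rightarrow> int" where
  "gi_norm n z = (fst z ^ 2 + snd z ^ 2) mod n"

definition gi_units :: "int \<Rightarrow> (int \<times> int) set" where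
  "gi_units n = {z \<in> gi_carrier n. gi_norm n z = 1 mod n}"

definition gi_cayley_adj :: "int \<Rightarrow> (int \<times> int) set \<Rightarrow> int \<times> int \<Rightarrow> int \<times> int \<Rightarrow> bool" where
  "gi_cayley_adj n S u v \<longleftrightarrow> gi_diff n v u \<in> S"

end

theory Submission
  imports Defs "HOL-Library.Real_Mod" "HOL-Number_Theory.Residues" "HOL-Algebra.Algebraic_Closure_Type"
    "Berlekamp_Zassenhaus.Finite_Field"
begin

hide_const (open) Divisibility.prime Divisibility.irreducible Polynomials.degree Polynomials.lead_coeff
  Coset.order

text \<open>
  The characters of the additive group diagonalise the Cayley graph. After a rotation, the
  eigenvalue of a nontrivial character is \<open>- T\<close>, where \<open>T = \<Sum>x. \<psi> x * \<chi> (x\<^sup>2 - d)\<close> with the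
  quadratic character \<open>\<chi>\<close> is a Kloosterman sum in disguise, so the claim is Weil's bound \<open>\<bar>T\<bar> \<le> 2 \<surd>p\<close>.

  The analogous sums over the extension of degree $n$ are \<open>- (\<alpha>\<^sup>n + \<beta>\<^sup>n)\<close> with \<open>\<alpha> + \<beta> = - T\<close> and \<open>\<alpha> \<beta> = p\<close>,
  because the L-function of the multiplicative function \<open>f \<mapsto> \<psi> (trace f) * \<chi> (norm f)\<close> on monic
  polynomials is \<open>1 + T z + p z\<^sup>2\<close>. If \<open>\<bar>T\<bar> > 2 \<surd>p\<close>, then \<open>\<alpha>\<close> and \<open>\<beta>\<close> are real, one of them exceeds
  \<open>\<surd>p\<close> in absolute value, and for even $n$ the sum of all these power sums over the nontrivial
  \<open>\<psi>\<close> grows faster than \<open>q\<^sup>1\<^sup>/\<^sup>2\<close>, where \<open>q = p\<^sup>n\<close>. But this sum is governed by the number of points on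
  \<open>y\<^sup>2 = (x\<^sup>p - x)\<^sup>2 - d\<close> over the field with $q$ elements, which Stepanov's method bounds with an error
  \<open>O(q\<^sup>1\<^sup>/\<^sup>2)\<close>: pigeonhole gives a nonzero auxiliary polynomial of degree \<open>q / 2 + O(q\<^sup>1\<^sup>/\<^sup>2)\<close> that vanishes
  at every $x$ where the right-hand side is not a square. Raising it to the power \<open>q\<^sup>1\<^sup>/\<^sup>2\<close>, which is a
  Frobenius map, turns this vanishing into a system of linear equations of small rank.
\<close>

subsection \<open>Finite fields inside an algebraic closure\<close>

lemma sum_order_eq_degree:
  fixes f :: "'a :: alg_closed_field poly"
  assumes "f \<noteq> 0"
  shows "(\<Sum>x | poly f x = 0. order x f) = degree f"
proof -
  obtain A where A: "size A = degree f" "f = smult (lead_coeff f) (\<Prod>x\<in>#A. [:-x, 1:])"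
    using alg_closed_imp_factorization[OF assms] by blast
  have "proots f = proots (\<Prod>x\<in>#A. [:-x, 1:])"
    by (subst A(2)) (use assms in \<open>simp add: proots_smult\<close>)
  also have "\<dots> = (\<Sum>x\<in>#A. proots [:-x, 1:])"
    by (subst proots_prod_mset[of "image_mset (\<lambda>x. [:-x, 1:]) A", simplified])
       (auto simp: image_mset.compositionality o_def)
  also have "\<dots> = A" by (simp add: proots_linear_factor)
  finally have "size (proots f) = degree f" using A by simp
  thus ?thesis using assms unfolding size_multiset_overloaded_eq by simp
qed

text \<open>In a closed field the multiplicities of the roots add up to the degree, and here all of
  them are 1.\<close>

lemma card_roots_rsquarefree:
  fixes f :: "'a :: alg_closed_field poly"
  assumes "rsquarefree f"
  shows "card {x. poly f x = 0} = degree f"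
proof -
  have "f \<noteq> 0" using assms by (auto simp: rsquarefree_def)
  have "card {x. poly f x = 0} = (\<Sum>x | poly f x = 0. 1)" by simp
  also have "\<dots> = (\<Sum>x | poly f x = 0. order x f)"
    by (intro sum.cong refl) (use assms rsquarefree_root_order \<open>f \<noteq> 0\<close> in force)
  finally show ?thesis using sum_order_eq_degree[OF \<open>f \<noteq> 0\<close>] by simp
qed

lemma rsquarefreeI:
  fixes f :: "'a :: field poly"
  assumes "f \<noteq> 0" "\<And>x. poly f x = 0 \<Longrightarrow> poly (pderiv f) x \<noteq> 0"
  shows "rsquarefree f"
  unfolding rsquarefree_def
proof (intro conjI allI)
  fix x
  have "order x f < 2"
  proof (rule ccontr)
    assume "\<not> order x f < 2"
    hence "[:-x, 1:] ^ 2 dvd f" by (simp add: order_divides)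
    then obtain g where g: "f = [:-x, 1:] ^ 2 * g" by (elim dvdE)
    have "poly f x = 0" unfolding g by simp
    moreover have "poly (pderiv f) x = 0"
      unfolding g power2_eq_square pderiv_mult by simp
    ultimately show False using assms(2) by blast
  qed
  thus "order x f = 0 \<or> order x f = 1" by linarith
qed (use assms in auto)

text \<open>For \<open>q = p ^ n\<close> in a closed field of characteristic \<open>p\<close> this
  is the subfield with \<open>q\<close> elements. As finite fields are subsets of a single type, the
  exponent \<open>n\<close> can vary within a proof.\<close>

definition Fq :: "nat \<Rightarrow> 'a::monoid_mult set" where
  "Fq q = {x. x ^ q = x}"

lemma Fq_mult: "x \<in> Fq q \<Longrightarrow> y \<in> Fq q \<Longrightarrow> x * y \<in> Fq q"
  for x y :: "'a::comm_monoid_mult"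
  by (simp add: Fq_def power_mult_distrib)

lemma Fq_1 [simp]: "1 \<in> Fq q"
  by (simp add: Fq_def)

lemma Fq_power: "x \<in> Fq q \<Longrightarrow> x ^ n \<in> Fq q"
  by (simp add: Fq_def flip: power_mult) (metis mult.commute power_mult)

lemma Fq_divide: "x \<in> Fq q \<Longrightarrow> y \<in> Fq q \<Longrightarrow> x / y \<in> Fq q"
  for x y :: "'a::field"
  by (simp add: Fq_def power_divide)

locale fp_closure =
  fixes p :: nat and K :: "'k::alg_closed_field itself"
  assumes prime_p: "prime p" and p_gt_2: "p > 2" and char_K: "CHAR('k) = p"
begin

lemma prime_char: "prime CHAR('k)"
  by (simp add: char_K prime_p)

lemma p_pos [simp]: "p > 0"
  using p_gt_2 by simp

lemma odd_p: "odd p"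
  using prime_p p_gt_2 prime_odd_nat by blast

lemma p_power_pos: "p ^ n > 0"
  by simp

lemma odd_p_power: "odd (p ^ n)"
  using odd_p by simp

lemma p_power_gt_1: "n > 0 \<Longrightarrow> p ^ n > 1"
  using p_gt_2 by (intro one_less_power) auto

lemma frob_add: "(x + y :: 'k) ^ (p ^ n) = x ^ (p ^ n) + y ^ (p ^ n)"
  by (rule freshmans_dream'[OF prime_char]) (simp add: char_K)

lemma frob_uminus: "(- x :: 'k) ^ (p ^ n) = - (x ^ (p ^ n))"
  using odd_p_power by simp

lemma frob_diff: "(x - y :: 'k) ^ (p ^ n) = x ^ (p ^ n) - y ^ (p ^ n)"
  using frob_add[of x "- y" n] frob_uminus[of y n] by simp

lemma frob_sum: "(sum f A :: 'k) ^ (p ^ n) = (\<Sum>i\<in>A. f i ^ (p ^ n))"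
  by (rule freshmans_dream_sum'[OF prime_char]) (simp add: char_K)

lemma frob_inj: "x ^ (p ^ n) = y ^ (p ^ n) \<Longrightarrow> x = (y :: 'k)"
  using frob_diff[of x y n] by (metis eq_iff_diff_eq_0 power_eq_0_iff)

lemma frob_poly: "poly f (x :: 'k) ^ (p ^ n) = poly (map_poly (\<lambda>c. c ^ (p ^ n)) f) (x ^ (p ^ n))"
proof (induction f)
  case 0
  show ?case by (simp add: power_0_left)
next
  case (pCons a f)
  thus ?case
    by (simp add: map_poly_pCons power_0_left frob_add power_mult_distrib)
qed

lemma Fq_add: "x \<in> Fq (p ^ n) \<Longrightarrow> y \<in> Fq (p ^ n) \<Longrightarrow> (x :: 'k) + y \<in> Fq (p ^ n)"
  by (simp add: Fq_def frob_add)

lemma Fq_uminus: "x \<in> Fq (p ^ n) \<Longrightarrow> - (x :: 'k) \<in> Fq (p ^ n)"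
  unfolding Fq_def mem_Collect_eq frob_uminus by simp

lemma Fq_uminus_iff: "- (x :: 'k) \<in> Fq (p ^ n) \<longleftrightarrow> x \<in> Fq (p ^ n)"
  using Fq_uminus[of x n] Fq_uminus[of "-x" n] by auto

lemma Fq_diff: "x \<in> Fq (p ^ n) \<Longrightarrow> y \<in> Fq (p ^ n) \<Longrightarrow> (x :: 'k) - y \<in> Fq (p ^ n)"
  by (simp add: Fq_def frob_diff)

lemma Fq_0 [simp]: "(0 :: 'k) \<in> Fq (p ^ n)"
  by (simp add: Fq_def power_0_left)

lemma Fq_of_nat: "of_nat m \<in> (Fq (p ^ n) :: 'k set)"
  by (induction m) (auto intro: Fq_add)

lemma Fq_of_int: "of_int m \<in> (Fq (p ^ n) :: 'k set)"
  by (cases m) (auto intro!: Fq_of_nat Fq_diff Fq_uminus)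

lemma frob_p: "x \<in> Fq p \<Longrightarrow> x ^ (p ^ n) = x" for x :: 'k
proof (induction n)
  case (Suc n)
  thus ?case by (simp add: Fq_def power_mult)
qed simp

lemma Fp_subset: "Fq p \<subseteq> (Fq (p ^ n) :: 'k set)"
  using frob_p by (auto simp: Fq_def)

lemmas Fp_add = Fq_add[where n=1, simplified]
lemmas Fp_uminus = Fq_uminus[where n=1, simplified]
lemmas Fp_diff = Fq_diff[where n=1, simplified]
lemmas Fp_0 [simp] = Fq_0[where n=1, simplified]
lemmas Fp_of_int [simp] = Fq_of_int[where n=1, simplified]

text \<open>Since \<open>p ^ n\<close> vanishes in characteristic \<open>p\<close>, the derivative
  of X^q - X is -1 and no root is multiple. This yields the size of
  \<open>Fq (p ^ n)\<close>.\<close>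

lemma rsquarefree_Fq_poly:
  assumes "n > 0"
  shows "rsquarefree (monom 1 (p ^ n) - [:0, 1:] :: 'k poly)"
    and "degree (monom 1 (p ^ n) - [:0, 1:] :: 'k poly) = p ^ n"
proof -
  have "(of_nat (p ^ n) :: 'k) = 0"
    using assms char_K by (simp add: of_nat_eq_0_iff_char_dvd)
  hence "pderiv (monom 1 (p ^ n) - [:0, 1:] :: 'k poly) = - 1"
    by (simp add: pderiv_diff pderiv_monom pderiv_pCons one_pCons del: of_nat_power)
  thus "rsquarefree (monom 1 (p ^ n) - [:0, 1:] :: 'k poly)"
    by (intro rsquarefreeI) (auto simp del: of_nat_power)
  have "degree (monom 1 (p ^ n) + (- [:0, 1:]) :: 'k poly) = degree (monom 1 (p ^ n) :: 'k poly)"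
    by (rule degree_add_eq_left) (use p_power_gt_1[OF assms] in \<open>simp add: degree_monom_eq\<close>)
  thus "degree (monom 1 (p ^ n) - [:0, 1:] :: 'k poly) = p ^ n"
    unfolding add_uminus_conv_diff by (simp add: degree_monom_eq)
qed

lemma card_Fq: "n > 0 \<Longrightarrow> card (Fq (p ^ n) :: 'k set) = p ^ n"
  using card_roots_rsquarefree[OF rsquarefree_Fq_poly(1)] rsquarefree_Fq_poly(2)
  by (simp add: Fq_def poly_monom)

lemma finite_Fq: "n > 0 \<Longrightarrow> finite (Fq (p ^ n) :: 'k set)"
  using card_Fq[of n] p_power_gt_1[of n] by (intro card_ge_0_finite) simp

lemmas card_Fp = card_Fq[where n=1, simplified]
lemmas finite_Fp [simp] = finite_Fq[where n=1, simplified]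

lemma of_int_eq_iff_mod: "(of_int a :: 'k) = of_int b \<longleftrightarrow> [a = b] (mod int p)"
  using of_int_eq_iff_cong_CHAR[where ?'a='k] char_K by simp

lemma bij_of_int: "bij_betw of_int {0..<int p} (Fq p :: 'k set)"
proof -
  have inj: "inj_on (of_int :: int \<Rightarrow> 'k) {0..<int p}"
  proof (rule inj_onI)
    fix x y assume *: "x \<in> {0..<int p}" "y \<in> {0..<int p}" "(of_int x :: 'k) = of_int y"
    hence "[x = y] (mod int p)" by (simp only: of_int_eq_iff_mod)
    thus "x = y" using * by (simp add: cong_def)
  qed
  moreover have "of_int ` {0..<int p} = (Fq p :: 'k set)"
    by (rule card_subset_eq) (auto simp: card_image[OF inj] card_Fp)
  ultimately show ?thesis by (simp add: bij_betw_def)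
qed

lemma two_neq_0: "(2 :: 'k) \<noteq> 0"
proof
  assume "(2 :: 'k) = 0"
  hence "(of_nat 2 :: 'k) = 0" by simp
  hence "p dvd 2" unfolding of_nat_eq_0_iff_char_dvd char_K .
  with p_gt_2 show False by (auto dest: dvd_imp_le)
qed

lemma minus_one_neq_1: "(- 1 :: 'k) \<noteq> 1"
  using two_neq_0 by (metis add.right_inverse one_add_one)

text \<open>Euler's criterion serves as the definition of the quadratic character of the field with
  \<open>q\<close> elements; outside that field the values carry no meaning.\<close>

definition chi :: "nat \<Rightarrow> 'k \<Rightarrow> real" where
  "chi q w = (if w = 0 then 0 else if w ^ ((q - 1) div 2) = 1 then 1 else - 1)"

lemma chi_0 [simp]: "chi q 0 = 0" by (simp add: chi_def)
lemma chi_1 [simp]: "chi q 1 = 1" by (simp add: chi_def)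

lemma half_power_cases:
  fixes w :: 'k
  assumes "w \<in> Fq (p ^ n)" "w \<noteq> 0"
  shows "w ^ ((p ^ n - 1) div 2) = 1 \<or> w ^ ((p ^ n - 1) div 2) = - 1"
proof -
  have "w * w ^ (p ^ n - 1) = w * 1"
    using assms by (simp only: Fq_def mem_Collect_eq Suc_diff_1 p_power_pos mult_1_right flip: power_Suc)
  hence "w ^ (p ^ n - 1) = 1" using assms(2) by simp
  moreover have "(p ^ n - 1) div 2 * 2 = p ^ n - 1"
    by (rule dvd_div_mult_self) (use odd_p_power in simp)
  ultimately have "(w ^ ((p ^ n - 1) div 2)) ^ 2 = 1"
    unfolding power_mult [symmetric] by simp
  thus ?thesis unfolding power2_eq_1_iff .
qed

lemma chi_mult:
  assumes "w \<in> Fq (p ^ n)" "v \<in> Fq (p ^ n)"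
  shows "chi (p ^ n) (w * v) = chi (p ^ n) w * chi (p ^ n) v"
proof (cases "w = 0 \<or> v = 0")
  case False
  thus ?thesis
    using half_power_cases[OF assms(1)] half_power_cases[OF assms(2)] minus_one_neq_1
    by (auto simp: chi_def power_mult_distrib simp del: One_nat_def)
qed (auto simp: chi_def)

lemmas chi_mult_p = chi_mult[where n=1, simplified]

text \<open>For nonzero \<open>w\<close>, a square root \<open>y\<close> exists in the closed field
  and y^q = y * w^((q-1)/2). So the q-power map fixes or negates \<open>y\<close>, and the sign
  decides whether \<open>y\<close> lies in the finite field.\<close>

lemma card_square_roots:
  assumes "n > 0" "w \<in> Fq (p ^ n)"
  shows "real (card {y \<in> Fq (p ^ n). y ^ 2 = w}) = 1 + chi (p ^ n) w"
proof (cases "w = 0")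
  case True
  have "{y \<in> Fq (p ^ n). y ^ 2 = w} = {0}" using True by auto
  thus ?thesis using True by simp
next
  case False
  obtain y where y: "y ^ 2 = w" using nth_root_exists[of 2 w] by auto
  have "Suc (2 * ((q - 1) div 2)) = q" if "odd q" for q :: nat
    using that by presburger
  from this[OF odd_p_power] have "y ^ (p ^ n) = y ^ Suc (2 * ((p ^ n - 1) div 2))"
    by (simp only:)
  hence frob: "y ^ (p ^ n) = y * w ^ ((p ^ n - 1) div 2)"
    unfolding power_Suc power_mult y .
  have "y \<noteq> 0" using y False by auto
  have "y \<noteq> - y"
  proof
    assume "y = - y"
    hence "2 * y = 0" unfolding mult_2 by (simp add: eq_neg_iff_add_eq_0)
    with \<open>y \<noteq> 0\<close> two_neq_0 show False by simp
  qed
  have iff: "z ^ 2 = w \<longleftrightarrow> z = y \<or> z = - y" for z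
    unfolding y [symmetric] by (rule power2_eq_iff)
  show ?thesis
  proof (cases "w ^ ((p ^ n - 1) div 2) = 1")
    case True
    hence "y \<in> Fq (p ^ n)" using frob unfolding Fq_def by (simp only: mem_Collect_eq mult_1_right)
    hence "{z \<in> Fq (p ^ n). z ^ 2 = w} = {y, - y}" using Fq_uminus by (auto simp: iff)
    thus ?thesis using True False \<open>y \<noteq> - y\<close> by (simp add: chi_def)
  next
    case F: False
    hence "y \<notin> Fq (p ^ n)" using frob \<open>y \<noteq> 0\<close> unfolding Fq_def by simp
    hence "{z \<in> Fq (p ^ n). z ^ 2 = w} = {}" by (auto simp: iff Fq_uminus_iff)
    hence "card {z \<in> Fq (p ^ n). z ^ 2 = w} = 0" by (simp only: card.empty)
    thus ?thesis using False F by (simp add: chi_def)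
  qed
qed

text \<open>Counts the points of the hyperbola by the substitution $u = x - y$, $d / u = x + y$.\<close>
lemma sum_chi_hyperbola:
  assumes n: "n > 0" and d: "d \<in> Fq (p ^ n)" "d \<noteq> 0"
  shows "(\<Sum>x\<in>Fq (p ^ n). chi (p ^ n) (x ^ 2 - d)) = - 1"
proof -
  let ?F = "Fq (p ^ n) :: 'k set"
  have two: "2 \<in> ?F" using Fq_of_nat[of 2 n] by simp
  have "bij_betw (\<lambda>u. ((d / u + u) / 2, (d / u - u) / 2)) (?F - {0})
          (SIGMA x : ?F. {y \<in> ?F. y ^ 2 = x ^ 2 - d})"
  proof (rule bij_betw_byWitness[where f' = "\<lambda>(x, y). x - y"], goal_cases)
    case 1
    have "(d / u + u) / 2 - (d / u - u) / 2 = u" for u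
      using two_neq_0 by (simp add: diff_divide_distrib add_divide_distrib)
    thus ?case by simp
  next
    case 2
    show ?case
    proof (clarify, goal_cases)
      case (1 x y)
      hence e: "(x - y) * (x + y) = d" by (simp add: algebra_simps power2_eq_square)
      hence "x - y \<noteq> 0" using d by auto
      hence "d / (x - y) = x + y" using e by (simp add: field_simps)
      thus ?case using two_neq_0 by simp
    qed
  next
    case 3
    show ?case
    proof (rule image_subsetI)
      fix u assume u: "u \<in> ?F - {0}"
      hence du: "d / u \<in> ?F" using d by (intro Fq_divide) auto
      have *: "((a + b) / 2) ^ 2 - ((a - b) / 2) ^ 2 = a * b" for a b :: 'k
      proof -
        have "((a + b) / 2) ^ 2 - ((a - b) / 2) ^ 2 = ((a + b) / 2 - (a - b) / 2) * ((a + b) / 2 + (a - b) / 2)"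
          by (simp add: algebra_simps power2_eq_square)
        also have "\<dots> = b * a"
          using two_neq_0 by (simp add: diff_divide_distrib add_divide_distrib)
        finally show ?thesis by simp
      qed
      have "((d / u - u) / 2) ^ 2 = ((d / u + u) / 2) ^ 2 - d"
        using *[of "d / u" u] u by (simp add: algebra_simps)
      moreover have "(d / u + u) / 2 \<in> ?F" "(d / u - u) / 2 \<in> ?F"
        using du u two by (blast intro: Fq_divide Fq_add Fq_diff)+
      ultimately show "((d / u + u) / 2, (d / u - u) / 2) \<in> (SIGMA x : ?F. {y \<in> ?F. y ^ 2 = x ^ 2 - d})"
        by blast
    qed
  next
    case 4
    show ?case using d by (auto intro!: Fq_diff)
  qed
  hence "card (?F - {0}) = card (SIGMA x : ?F. {y \<in> ?F. y ^ 2 = x ^ 2 - d})"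
    by (rule bij_betw_same_card)
  also have "\<dots> = (\<Sum>x\<in>?F. card {y \<in> ?F. y ^ 2 = x ^ 2 - d})"
    by (rule card_SigmaI) (auto simp: finite_Fq n)
  finally have "real (card (?F - {0})) = (\<Sum>x\<in>?F. 1 + chi (p ^ n) (x ^ 2 - d))"
    using d by (simp add: card_square_roots[OF n] Fq_diff Fq_power)
  thus ?thesis
    using card_Fq[OF n] finite_Fq[OF n] p_power_gt_1[OF n]
    by (simp add: sum.distrib card_Diff_singleton of_nat_diff)
qed

end

subsection \<open>Characters and polynomials over the prime field\<close>

definition ec :: "nat \<Rightarrow> int \<Rightarrow> complex" where
  "ec n i = cis (2 * pi * real_of_int i / real n)"

lemma ec_0 [simp]: "ec n 0 = 1"
  by (simp add: ec_def)

lemma ec_add: "ec n (i + j) = ec n i * ec n j"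
  by (simp add: ec_def cis_mult ring_distribs add_divide_distrib)

lemma cnj_ec: "cnj (ec n i) = ec n (- i)"
  by (simp add: ec_def cis_cnj)

lemma ec_mult_nat: "ec n (i * int m) = ec n i ^ m"
  by (simp add: ec_def DeMoivre mult_ac)

lemma ec_eq_1_iff:
  assumes "n > 0"
  shows "ec n i = 1 \<longleftrightarrow> int n dvd i"
proof -
  have "ec n i = 1 \<longleftrightarrow> (\<exists>k. real_of_int i = real_of_int (int n * k))"
    using assms by (simp add: ec_def cis_eq_1_iff field_simps)
  also have "\<dots> \<longleftrightarrow> int n dvd i"
    unfolding of_int_eq_iff dvd_def ..
  finally show ?thesis .
qed

lemma ec_cong:
  assumes "n > 0" "[i = j] (mod int n)"
  shows "ec n i = ec n j"
proof -
  have "ec n (i - j) = 1"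
    using assms by (simp add: ec_eq_1_iff cong_iff_dvd_diff)
  thus ?thesis using ec_add[of n "i - j" j] by simp
qed

lemma sum_ec:
  assumes "n > 0"
  shows "(\<Sum>i\<in>{0..<int n}. ec n (a * i)) = (if int n dvd a then of_nat n else 0)"
proof -
  have "(\<Sum>i\<in>{0..<int n}. ec n (a * i)) = (\<Sum>i<n. ec n a ^ i)"
    by (rule sum.reindex_bij_witness[of _ int nat]) (auto simp flip: ec_mult_nat)
  also have "\<dots> = (if int n dvd a then of_nat n else 0)"
  proof (cases "int n dvd a")
    case True
    hence "ec n a = 1" using assms by (simp add: ec_eq_1_iff)
    thus ?thesis using True by simp
  next
    case False
    have "ec n a ^ n = 1"
      using assms by (simp add: ec_eq_1_iff flip: ec_mult_nat)
    thus ?thesis using False assms by (simp add: geometric_sum ec_eq_1_iff)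
  qed
  finally show ?thesis .
qed

context fp_closure
begin

abbreviation F :: "nat \<Rightarrow> 'k set" where "F n \<equiv> Fq (p ^ n)"
abbreviation Fp :: "'k set" where "Fp \<equiv> Fq p"

definition idx :: "'k \<Rightarrow> int" where
  "idx x = inv_into {0..<int p} of_int x"

lemma idx: "x \<in> Fp \<Longrightarrow> idx x \<in> {0..<int p}" "x \<in> Fp \<Longrightarrow> of_int (idx x) = x"
  using bij_of_int unfolding idx_def bij_betw_def
  by (metis inv_into_into, metis f_inv_into_f)

text \<open>As \<open>a\<close> runs through \<open>{0..<int p}\<close> these are all additive
  characters of the prime field, the trivial one being \<open>a = 0\<close>. Only arguments in
  \<open>Fp\<close> are meaningful.\<close>

definition psi :: "int \<Rightarrow> 'k \<Rightarrow> complex" where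
  "psi a x = ec p (a * idx x)"

lemma psi_of_int: "psi a (of_int i) = ec p (a * i)"
proof -
  have "(of_int (idx (of_int i)) :: 'k) = of_int i" by (intro idx) simp
  hence "[idx (of_int i) = i] (mod int p)" unfolding of_int_eq_iff_mod .
  thus ?thesis unfolding psi_def by (intro ec_cong cong_scalar_left) simp_all
qed

lemma psi_add:
  assumes "x \<in> Fp" "y \<in> Fp"
  shows "psi a (x + y) = psi a x * psi a y"
proof -
  have "psi a (of_int (idx x) + of_int (idx y)) = psi a (of_int (idx x)) * psi a (of_int (idx y))"
    unfolding of_int_add [symmetric] psi_of_int by (simp add: ring_distribs ec_add)
  thus ?thesis using assms by (simp add: idx)
qed

lemma psi_0 [simp]: "psi a 0 = 1"
  using psi_of_int[of a 0] by simp

lemma psi_uminus: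
  assumes "x \<in> Fp"
  shows "psi a (- x) = cnj (psi a x)"
proof -
  have "psi a (- of_int (idx x)) = cnj (psi a (of_int (idx x)))"
    unfolding of_int_minus [symmetric] psi_of_int by (simp add: cnj_ec)
  thus ?thesis using assms by (simp add: idx)
qed

lemma psi_0_left [simp]: "psi 0 x = 1"
  by (simp add: psi_def)

lemma sum_psi: "(\<Sum>x\<in>Fp. psi a x) = (if int p dvd a then of_nat p else 0)"
proof -
  have "(\<Sum>x\<in>Fp. psi a x) = (\<Sum>i\<in>{0..<int p}. psi a (of_int i))"
    by (rule sum.reindex_bij_betw[OF bij_of_int, symmetric])
  thus ?thesis by (simp add: psi_of_int sum_ec)
qed

lemma sum_psi_chars:
  assumes "x \<in> Fp"
  shows "(\<Sum>a\<in>{0..<int p}. psi a x) = (if x = 0 then of_nat p else 0)"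
proof -
  have "(\<Sum>a\<in>{0..<int p}. psi a x) = (\<Sum>a\<in>{0..<int p}. ec p (idx x * a))"
    by (simp add: psi_def mult.commute)
  moreover have "int p dvd idx x \<longleftrightarrow> x = 0"
    using idx(2)[OF assms] of_int_eq_iff_mod[of "idx x" 0] by (auto simp: cong_0_iff)
  ultimately show ?thesis by (simp add: sum_ec)
qed

lemma psi_minus_1:
  assumes "\<not> int p dvd a"
  shows "psi a (- 1) \<noteq> 1"
  using psi_of_int[of a "- 1"] assms by (simp add: ec_eq_1_iff)

section \<open>Polynomials over the prime field as fixed points of Frobenius on coefficients\<close>

definition frobp :: "'k poly \<Rightarrow> 'k poly" where
  "frobp f = map_poly (\<lambda>c. c ^ p) f"

lemma coeff_frobp [simp]: "coeff (frobp f) i = coeff f i ^ p"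
  by (simp add: frobp_def coeff_map_poly power_0_left)

lemma frobp_mult: "frobp (f * g) = frobp f * frobp g"
  by (rule poly_eqI)
     (simp add: coeff_mult frob_sum[where n=1, simplified] power_mult_distrib)

lemma frobp_1 [simp]: "frobp 1 = 1"
  using p_pos by (intro poly_eqI) (auto simp: coeff_1 zero_power)

lemma frobp_prod: "frobp (\<Prod>i\<in>A. f i) = (\<Prod>i\<in>A. frobp (f i))"
  by (induction A rule: infinite_finite_induct) (auto simp: frobp_mult)

lemma frobp_power: "frobp (f ^ n) = frobp f ^ n"
  by (induction n) (auto simp: frobp_mult)

lemma frobp_linear: "frobp [:- x, 1:] = [:- (x ^ p), 1:]"
  using odd_p by (intro poly_eqI) (auto simp: coeff_pCons power_0_left split: nat.splits)

definition Fpoly :: "'k poly set" where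
  "Fpoly = {f. \<forall>i. coeff f i \<in> Fp}"

text \<open>The purpose of \<open>frobp\<close>: as it is multiplicative, closure of
  \<open>Fpoly\<close> under products and under cancelling a factor becomes a ring equation.\<close>

lemma Fpoly_frobp: "f \<in> Fpoly \<longleftrightarrow> frobp f = f"
  by (auto simp: Fpoly_def poly_eq_iff Fq_def)

lemma Fpoly_mult: "f \<in> Fpoly \<Longrightarrow> g \<in> Fpoly \<Longrightarrow> f * g \<in> Fpoly"
  by (simp add: Fpoly_frobp frobp_mult)

lemma Fpoly_add: "f \<in> Fpoly \<Longrightarrow> g \<in> Fpoly \<Longrightarrow> f + g \<in> Fpoly"
  by (auto simp: Fpoly_def intro: Fp_add)

lemma Fpoly_diff: "f \<in> Fpoly \<Longrightarrow> g \<in> Fpoly \<Longrightarrow> f - g \<in> Fpoly"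
  by (auto simp: Fpoly_def intro: Fp_diff)

lemma Fpoly_cancel:
  assumes "f * g \<in> Fpoly" "f \<in> Fpoly" "f \<noteq> 0"
  shows "g \<in> Fpoly"
  using assms by (simp add: Fpoly_frobp frobp_mult)

lemma Fpoly_pCons: "pCons c f \<in> Fpoly \<longleftrightarrow> c \<in> Fp \<and> f \<in> Fpoly"
  by (auto simp: Fpoly_def coeff_pCons split: nat.splits)

lemma Fpoly_0 [simp]: "0 \<in> Fpoly"
  by (simp add: Fpoly_def)

lemma Fpoly_1 [simp]: "1 \<in> Fpoly"
  by (simp add: Fpoly_frobp)

lemma finite_Fpoly: "finite {f \<in> Fpoly. degree f \<le> m}"
proof (rule finite_subset)
  show "{f \<in> Fpoly. degree f \<le> m} \<subseteq> Poly ` {xs. set xs \<subseteq> Fp \<and> length xs \<le> Suc m}"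
  proof
    fix f :: "'k poly" assume f: "f \<in> {f \<in> Fpoly. degree f \<le> m}"
    have "set (coeffs f) \<subseteq> Fp"
      using f by (auto simp: Fpoly_def coeffs_def)
    moreover have "length (coeffs f) \<le> Suc m"
      using f by (simp add: coeffs_def)
    moreover have "f = Poly (coeffs f)" by simp
    ultimately show "f \<in> Poly ` {xs. set xs \<subseteq> Fp \<and> length xs \<le> Suc m}" by blast
  qed
qed (intro finite_imageI finite_lists_length_le finite_Fp)

section \<open>Monic polynomials over the prime field, Frobenius orbits and multiplicities of
  roots\<close>

definition Mon :: "nat \<Rightarrow> 'k poly set" where
  "Mon m = {f \<in> Fpoly. monic f \<and> degree f = m}"

lemma finite_Mon: "finite (Mon m)"
  by (rule finite_subset[OF _ finite_Fpoly[of m]]) (auto simp: Mon_def)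

lemma Mon_mult: "f \<in> Mon m \<Longrightarrow> g \<in> Mon n \<Longrightarrow> f * g \<in> Mon (m + n)"
  by (auto simp: Mon_def Fpoly_mult lead_coeff_mult intro!: degree_mult_eq) 

lemma Mon_cancel:
  assumes "f * g \<in> Mon m" "f \<in> Mon k"
  shows "k \<le> m" "g \<in> Mon (m - k)"
proof -
  have nz: "f \<noteq> 0" "g \<noteq> 0" using assms by (auto simp: Mon_def)
  hence "degree (f * g) = degree f + degree g" by (rule degree_mult_eq)
  moreover have "lead_coeff g = 1"
  proof -
    have "lead_coeff (f * g) = 1" "lead_coeff f = 1" using assms by (auto simp: Mon_def)
    thus ?thesis unfolding lead_coeff_mult by simp
  qed
  moreover have "g \<in> Fpoly" using assms nz by (auto simp: Mon_def intro: Fpoly_cancel)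
  ultimately show "k \<le> m" "g \<in> Mon (m - k)" using assms by (auto simp: Mon_def)
qed

text \<open>For \<open>x \<in> F k\<close> this is the characteristic polynomial of $x$ over the prime field.\<close>
definition M :: "nat \<Rightarrow> 'k \<Rightarrow> 'k poly" where
  "M k x = (\<Prod>i<k. [:- (x ^ p ^ i), 1:])"

lemma degree_M [simp]: "degree (M k x) = k"
  unfolding M_def by (subst degree_prod_eq_sum_degree) auto

lemma monic_M: "monic (M k x)"
  unfolding M_def by (intro monic_prod) auto

lemma M_nonzero [simp]: "M k x \<noteq> 0"
  using monic_M[of k x] by auto

lemma M_add: "M (a + b) x = M a x * M b (x ^ p ^ a)"
proof (induction b)
  case (Suc b)
  thus ?case
    by (simp add: M_def power_add mult_ac flip: power_mult)
qed (simp add: M_def)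

text \<open>Frobenius on coefficients shifts the linear factors by one place, and the cycle closes
  because x^(p^k) = x.\<close>

lemma M_in_Mon:
  assumes "x \<in> F k"
  shows "M k x \<in> Mon k"
proof (cases k)
  case 0
  thus ?thesis by (simp add: M_def Mon_def)
next
  case (Suc n)
  have "frobp (M k x) = (\<Prod>i<k. [:- (x ^ p ^ Suc i), 1:])"
    unfolding M_def frobp_prod frobp_linear by (simp add: mult_ac flip: power_mult)
  also have "\<dots> = (\<Prod>i<n. [:- (x ^ p ^ Suc i), 1:]) * [:- (x ^ p ^ k), 1:]"
    by (simp add: Suc del: power_Suc)
  also have "x ^ p ^ k = x ^ p ^ 0" using assms by (simp add: Fq_def)
  also have "(\<Prod>i<n. [:- (x ^ p ^ Suc i), 1:]) * [:- (x ^ p ^ 0), 1:] = M k x"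
    unfolding M_def Suc by (subst prod.lessThan_Suc_shift) (rule mult.commute)
  finally show ?thesis using monic_M[of k x] by (simp add: Mon_def Fpoly_frobp)
qed

text \<open>\<open>frobp\<close> fixes \<open>f\<close> and turns a factor X - y into X - y^p, so
  multiplicities cannot drop along a Frobenius orbit.\<close>

lemma order_frob:
  assumes "f \<in> Fpoly" "f \<noteq> 0"
  shows "order x f \<le> order (x ^ p ^ n) f"
proof (induction n)
  case (Suc n)
  let ?y = "x ^ p ^ n"
  obtain g where g: "f = [:- ?y, 1:] ^ order ?y f * g"
    using order_1[of ?y f] by (elim dvdE)
  have "f = frobp f" using assms by (simp add: Fpoly_frobp)
  also have "\<dots> = [:- (?y ^ p), 1:] ^ order ?y f * frobp g"
    by (subst g) (simp only: frobp_mult frobp_power frobp_linear)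
  finally have "[:- (?y ^ p), 1:] ^ order ?y f dvd f" by (rule dvdI)
  hence "order ?y f \<le> order (?y ^ p) f" using assms by (simp add: order_divides)
  thus ?case using Suc by (simp add: mult_ac flip: power_mult)
qed simp

lemma prod_linear_power_dvd:
  fixes f :: "'k poly"
  assumes "finite A" "f \<noteq> 0" "\<And>a. a \<in> A \<Longrightarrow> n \<le> order a f"
  shows "(\<Prod>a\<in>A. [:- a, 1:]) ^ n dvd f"
  using assms(1,3)
proof (induction A)
  case (insert a A)
  let ?P = "(\<Prod>a\<in>A. [:- a, 1:]) ^ n"
  obtain g where g: "f = ?P * g" using insert by (auto elim: dvdE)
  have "poly ?P a \<noteq> 0" using insert.hyps by (auto simp: poly_prod)
  hence "order a f = order a g"
    using assms(2) unfolding g by (subst order_mult) (auto simp: order_0I)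
  hence "n \<le> order a g" using insert.prems[of a] by simp
  hence "[:- a, 1:] ^ n dvd g" by (simp add: order_divides)
  hence "?P * [:- a, 1:] ^ n dvd f" unfolding g by (rule mult_dvd_mono[OF dvd_refl])
  thus ?case unfolding prod.insert[OF insert.hyps] power_mult_distrib by (simp only: mult.commute)
qed simp


text \<open>The Frobenius orbit of a root consists of roots, hence is finite. Two of its members
  coincide, and injectivity of Frobenius cancels the smaller exponent.\<close>

lemma orbit_length_exists:
  assumes "f \<in> Fpoly" "f \<noteq> 0" "poly f x = 0"
  shows "\<exists>k>0. x \<in> F k"
proof -
  have "x ^ p ^ n \<in> {y. poly f y = 0}" for n
    using order_frob[OF assms(1,2), of x n] assms(2,3) by (auto simp: order_root)
  hence "range (\<lambda>n. x ^ p ^ n) \<subseteq> {y. poly f y = 0}" by blast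
  hence "finite (range (\<lambda>n. x ^ p ^ n))"
    using poly_roots_finite[OF assms(2)] finite_subset by blast
  hence "\<not> inj (\<lambda>n. x ^ p ^ n)" using finite_imageD by blast
  then obtain i j where ij: "x ^ p ^ i = x ^ p ^ j" "i \<noteq> j" by (auto simp: inj_def)
  have "\<exists>k>0. x \<in> F k" if "x ^ p ^ i = x ^ p ^ j" "i < j" for i j
  proof -
    have "(x ^ p ^ (j - i)) ^ p ^ i = x ^ p ^ i"
      using that by (simp flip: power_mult power_add)
    hence "x \<in> F (j - i)" using frob_inj[of "x ^ p ^ (j - i)" i x] by (simp add: Fq_def)
    thus ?thesis using that by (intro exI[of _ "j - i"]) auto
  qed
  from this[of i j] this[of j i] ij show ?thesis by (metis linorder_neqE_nat)
qed

text \<open>For \<open>x\<close> in some finite field this is the degree of \<open>x\<close> over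
  the prime field, and \<open>M (orbit_length x) x\<close> is its minimal polynomial.\<close>

definition orbit_length :: "'k \<Rightarrow> nat" where
  "orbit_length x = (LEAST k. k > 0 \<and> x \<in> F k)"

lemma orbit_length:
  assumes "k > 0" "x \<in> F k"
  shows "orbit_length x > 0" "x \<in> F (orbit_length x)" "orbit_length x \<le> k"
proof -
  have "orbit_length x > 0 \<and> x \<in> F (orbit_length x)"
    unfolding orbit_length_def by (rule LeastI[of _ k]) (use assms in auto)
  thus "orbit_length x > 0" "x \<in> F (orbit_length x)" by auto
  show "orbit_length x \<le> k"
    unfolding orbit_length_def by (rule Least_le) (use assms in auto)
qed

lemma frob_mult_period:
  assumes "x \<in> F e"
  shows "x ^ p ^ (e * j) = x"
proof (induction j)
  case (Suc j)
  have "x ^ p ^ (e * Suc j) = (x ^ p ^ (e * j)) ^ p ^ e"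
    by (simp add: power_add mult_ac flip: power_mult)
  thus ?case using Suc assms by (simp add: Fq_def)
qed simp

lemma F_iff_orbit_length_dvd:
  assumes "k > 0" "x \<in> F k"
  shows "x \<in> F n \<longleftrightarrow> orbit_length x dvd n"
proof
  let ?e = "orbit_length x"
  note e = orbit_length[OF assms]
  show "x \<in> F n" if "?e dvd n"
    using that frob_mult_period[OF e(2)] by (auto simp: Fq_def)
  assume "x \<in> F n"
  have "x ^ p ^ n = (x ^ p ^ (?e * (n div ?e))) ^ p ^ (n mod ?e)"
    by (simp flip: power_mult power_add)
  also have "x ^ p ^ (?e * (n div ?e)) = x" by (rule frob_mult_period[OF e(2)])
  finally have "x \<in> F (n mod ?e)" using \<open>x \<in> F n\<close> by (simp add: Fq_def)
  hence "n mod ?e = 0"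
    using orbit_length(3)[of "n mod ?e" x] e(1) by (meson leD mod_less_divisor neq0_conv)
  thus "?e dvd n" by auto
qed

lemma M_mult_period:
  assumes "x \<in> F e"
  shows "M (e * j) x = M e x ^ j"
proof (induction j)
  case (Suc j)
  have "M (e * Suc j) x = M (e * j + e) x" by (simp add: add.commute)
  also have "\<dots> = M e x ^ Suc j"
    unfolding M_add by (simp add: Suc frob_mult_period[OF assms] mult.commute)
  finally show ?case .
qed (simp add: M_def)

text \<open>The first \<open>orbit_length x\<close> conjugates of \<open>x\<close> are distinct, and
  by \<open>order_frob\<close> each is a root of \<open>f\<close> at least as often as
  \<open>x\<close>.\<close>

lemma M_power_dvd_iff:
  assumes "f \<in> Fpoly" "f \<noteq> 0" "k > 0" "x \<in> F k"
  shows "M (orbit_length x) x ^ j dvd f \<longleftrightarrow> j \<le> order x f"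
proof
  let ?e = "orbit_length x"
  note e = orbit_length[OF assms(3,4)]
  assume "M ?e x ^ j dvd f"
  moreover have "[:- x, 1:] dvd M ?e x"
    unfolding M_def using e(1) by (intro dvd_prodI[of _ 0 "\<lambda>i. [:- (x ^ p ^ i), 1:]", simplified]) auto
  ultimately have "[:- x, 1:] ^ j dvd f" using dvd_power_same dvd_trans by blast
  thus "j \<le> order x f" using assms by (simp add: order_divides)
next
  let ?e = "orbit_length x"
  note e = orbit_length[OF assms(3,4)]
  assume j: "j \<le> order x f"
  have "inj_on (\<lambda>i. x ^ p ^ i) {..<?e}"
  proof (rule inj_onI)
    have "i = j" if "x ^ p ^ i = x ^ p ^ j" "i < ?e" "j < ?e" "i \<le> j" for i j
    proof -
      have "(x ^ p ^ (j - i)) ^ p ^ i = x ^ p ^ i"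
        using that by (simp flip: power_mult power_add)
      hence "x \<in> F (j - i)" using frob_inj[of "x ^ p ^ (j - i)" i x] by (simp add: Fq_def)
      hence "?e dvd j - i" using F_iff_orbit_length_dvd[OF assms(3,4)] by simp
      moreover have "j - i < ?e" using that by simp
      ultimately have "j - i = 0" using nat_dvd_not_less by blast
      thus ?thesis using that by simp
    qed
    thus "i = j" if "i \<in> {..<?e}" "j \<in> {..<?e}" "x ^ p ^ i = x ^ p ^ j" for i j
      using that by (metis lessThan_iff nat_le_linear)
  qed
  hence "M ?e x = (\<Prod>a\<in>(\<lambda>i. x ^ p ^ i) ` {..<?e}. [:- a, 1:])"
    unfolding M_def by (subst prod.reindex) (simp_all add: o_def)
  moreover have "(\<Prod>a\<in>(\<lambda>i. x ^ p ^ i) ` {..<?e}. [:- a, 1:]) ^ j dvd f"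
    by (rule prod_linear_power_dvd) (use assms j order_frob[OF assms(1,2), of x] in \<open>auto intro: order_trans\<close>)
  ultimately show "M ?e x ^ j dvd f" by simp
qed

text \<open>The admissible \<open>k\<close> are exactly the multiples \<open>e * j\<close> of the
  orbit length \<open>e\<close> with \<open>1 \<le> j \<le> order x f\<close>, because
  \<open>M (e * j) x = M e x ^ j\<close>.\<close>

lemma card_M_dvd_eq_order:
  assumes f: "f \<in> Fpoly" "f \<noteq> 0" and x: "poly f x = 0"
  shows "card {k \<in> {1..degree f}. x \<in> F k \<and> M k x dvd f} = order x f"
proof -
  obtain k where k: "k > 0" "x \<in> F k" using orbit_length_exists[OF assms] by blast
  let ?e = "orbit_length x"
  note e = orbit_length[OF k]
  have "{k \<in> {1..degree f}. x \<in> F k \<and> M k x dvd f} = (\<lambda>j. ?e * j) ` {1..order x f}"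
  proof (intro equalityI subsetI)
    fix n assume n: "n \<in> {k \<in> {1..degree f}. x \<in> F k \<and> M k x dvd f}"
    then obtain j where j: "n = ?e * j" unfolding F_iff_orbit_length_dvd[OF k] dvd_def by blast
    hence "M ?e x ^ j dvd f" using n M_mult_period[OF e(2)] by simp
    hence "j \<le> order x f" using M_power_dvd_iff[OF f k] by simp
    moreover have "j \<ge> 1" using n j by (cases j) auto
    ultimately show "n \<in> (\<lambda>j. ?e * j) ` {1..order x f}"
      by (intro image_eqI[where x = j] j) simp
  next
    fix n assume "n \<in> (\<lambda>j. ?e * j) ` {1..order x f}"
    then obtain j where j': "n = ?e * j" "j \<in> {1..order x f}" by (rule imageE)
    have j: "n = ?e * j" "j \<ge> 1" "j \<le> order x f" using j' by (simp_all only: atLeastAtMost_iff)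
    have dvd: "M n x dvd f" unfolding j(1) M_mult_period[OF e(2)] M_power_dvd_iff[OF f k] by (rule j(3))
    hence "n \<le> degree f" using dvd_imp_degree_le[OF dvd f(2)] by simp
    moreover have "n \<ge> 1" using j e(1) by (simp add: Suc_le_eq)
    moreover have "x \<in> F n" unfolding F_iff_orbit_length_dvd[OF k] j(1) by (rule dvd_triv_left)
    ultimately show "n \<in> {k \<in> {1..degree f}. x \<in> F k \<and> M k x dvd f}"
      using dvd by (simp only: mem_Collect_eq atLeastAtMost_iff)
  qed
  moreover have "inj_on (\<lambda>j. ?e * j) {1..order x f}"
    using e(1) by (intro inj_onI) auto
  ultimately show ?thesis by (simp add: card_image)
qed

text \<open>Double counting of pairs of a degree and a root: each root accounts for as many
  \<open>k\<close> as its multiplicity. This takes the place of factoring \<open>f\<close> into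
  primes and adding up their degrees.\<close>

lemma sum_card_M_dvd:
  assumes "f \<in> Mon m"
  shows "(\<Sum>k=1..m. card {x \<in> F k. M k x dvd f}) = m"
proof -
  have f: "f \<in> Fpoly" "f \<noteq> 0" "degree f = m" using assms by (auto simp: Mon_def)
  let ?R = "{x. poly f x = 0}"
  have "{x \<in> F k. M k x dvd f} = {x \<in> ?R. x \<in> F k \<and> M k x dvd f}" if "k \<ge> 1" for k
  proof -
    have "poly f x = 0" if "M k x dvd f" for x
    proof -
      have "[:- x, 1:] dvd M k x" unfolding M_def using \<open>k \<ge> 1\<close>
        by (intro dvd_prodI[of _ 0 "\<lambda>i. [:- (x ^ p ^ i), 1:]", simplified]) auto
      thus ?thesis using that dvd_trans poly_eq_0_iff_dvd by blast
    qed
    thus ?thesis by auto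
  qed
  hence "(\<Sum>k=1..m. card {x \<in> F k. M k x dvd f}) = (\<Sum>k=1..m. card {x \<in> ?R. x \<in> F k \<and> M k x dvd f})"
    by (intro sum.cong refl) simp
  also have "\<dots> = (\<Sum>k=1..m. \<Sum>x\<in>?R. if x \<in> F k \<and> M k x dvd f then 1 else 0)"
    by (intro sum.cong refl) (simp only: card_eq_sum sum.inter_filter[OF poly_roots_finite[OF f(2)]])
  also have "\<dots> = (\<Sum>x\<in>?R. \<Sum>k=1..m. if x \<in> F k \<and> M k x dvd f then 1 else 0)"
    by (rule sum.swap)
  also have "\<dots> = (\<Sum>x\<in>?R. card {k \<in> {1..m}. x \<in> F k \<and> M k x dvd f})"
    by (intro sum.cong refl) (simp only: card_eq_sum sum.inter_filter[OF finite_atLeastAtMost])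
  also have "\<dots> = (\<Sum>x\<in>?R. order x f)"
    using card_M_dvd_eq_order[OF f(1,2)] f(3) by (intro sum.cong refl) auto
  also have "\<dots> = m" using sum_order_eq_degree[OF f(2)] f(3) by simp
  finally show ?thesis .
qed

end

subsection \<open>The L-function\<close>

context fp_closure
begin

section \<open>Traces and norms of field elements and of polynomials\<close>

definition Tr :: "nat \<Rightarrow> 'k \<Rightarrow> 'k" where
  "Tr k x = (\<Sum>i<k. x ^ p ^ i)"

lemma Tr_uminus: "Tr k (- x) = - Tr k x"
  by (simp add: Tr_def frob_uminus sum_negf)

lemma Tr_in_Fp:
  assumes "x \<in> F k"
  shows "Tr k x \<in> Fp"
proof (cases k)
  case (Suc n)
  have "Tr k x ^ p = (\<Sum>i<k. x ^ p ^ Suc i)"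
    unfolding Tr_def frob_sum[where n = 1, simplified] by (simp add: mult_ac flip: power_mult)
  also have "\<dots> = (\<Sum>i<n. x ^ p ^ Suc i) + x ^ p ^ k"
    by (simp add: Suc del: power_Suc)
  also have "x ^ p ^ k = x ^ p ^ 0" using assms by (simp add: Fq_def)
  also have "(\<Sum>i<n. x ^ p ^ Suc i) + x ^ p ^ 0 = Tr k x"
    unfolding Tr_def Suc by (subst sum.lessThan_Suc_shift) (rule add.commute)
  finally show ?thesis by (simp add: Fq_def)
qed (simp add: Tr_def)

text \<open>For monic \<open>f\<close> this is the sum of the roots. In the reflected polynomial the
  coefficient next to the leading one always has index 1, which also gives 0 for constants and makes
  additivity on products immediate.\<close>

definition trc :: "'k poly \<Rightarrow> 'k" where
  "trc f = - coeff (reflect_poly f) 1"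

lemma trc_mult:
  assumes "monic f" "monic g"
  shows "trc (f * g) = trc f + trc g"
  using assms by (simp add: trc_def reflect_poly_mult coeff_mult)

lemma trc_1 [simp]: "trc 1 = 0"
  by (simp add: trc_def)

lemma trc_linear [simp]: "trc [:- x, 1:] = x"
  by (simp add: trc_def coeff_reflect_poly)

lemma trc_M: "trc (M k x) = Tr k x"
proof (induction k)
  case (Suc k)
  have "M (Suc k) x = M k x * [:- (x ^ p ^ k), 1:]" by (simp add: M_def)
  hence "trc (M (Suc k) x) = trc (M k x) + trc [:- (x ^ p ^ k), 1:]"
    using monic_M[of k x] by (simp only:) (rule trc_mult, simp_all)
  thus ?case using Suc by (simp add: Tr_def)
qed (simp add: M_def Tr_def)

lemma trc_in_Fp: "f \<in> Fpoly \<Longrightarrow> trc f \<in> Fp"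
  by (auto simp: trc_def coeff_reflect_poly Fpoly_def intro!: Fp_uminus)

lemma chi_square:
  assumes "x \<in> F n" "x \<noteq> 0"
  shows "chi (p ^ n) (x ^ 2) = 1"
proof -
  have "chi (p ^ n) (x ^ 2) = chi (p ^ n) x ^ 2"
    using chi_mult[OF assms(1,1)] by (simp add: power2_eq_square)
  thus ?thesis using assms(2) by (simp add: chi_def)
qed

text \<open>The quadratic character of the extension is that of the prime field composed with the
  norm: (1 + p + ... + p^(k-1)) * (p-1)/2 = (p^k-1)/2.\<close>

lemma chi_prod_frob:
  assumes "k > 0"
  shows "chi p (\<Prod>i<k. w ^ p ^ i) = chi (p ^ k) w"
proof (cases "w = 0")
  case True
  have "(\<Prod>i<k. w ^ p ^ i) = 0"
    using assms True by (intro prod_zero bexI[of _ 0]) auto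
  thus ?thesis unfolding True by (simp only: chi_0)
next
  case False
  have "(\<Sum>i<k. p ^ i) * (2 * ((p - 1) div 2)) = p ^ k - 1"
  proof -
    have "2 * ((p - 1) div 2) = p - 1" using odd_p by simp
    moreover have "(\<Sum>i<k. p ^ i) * (p - 1) = p ^ k - 1"
    proof -
      have "int ((\<Sum>i<k. p ^ i) * (p - 1)) = int (p ^ k - 1)"
        using power_diff_1_eq[of "int p" k] p_pos p_power_pos[of k]
        by (simp add: of_nat_diff Suc_le_eq mult.commute del: p_pos)
      thus ?thesis by (simp only: of_nat_eq_iff)
    qed
    ultimately show ?thesis by simp
  qed
  hence "(\<Sum>i<k. p ^ i) * ((p - 1) div 2) = (p ^ k - 1) div 2"
    by simp
  hence "(\<Prod>i<k. w ^ p ^ i) ^ ((p - 1) div 2) = w ^ ((p ^ k - 1) div 2)"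
    by (simp only: power_sum [symmetric] power_mult [symmetric])
  thus ?thesis using False by (simp add: chi_def)
qed

end

locale kloosterman = fp_closure p K for p and K :: "'k::alg_closed_field itself" +
  fixes d s :: 'k
  assumes d_Fp: "d \<in> Fp" and d_nz: "d \<noteq> 0" and s_square: "s ^ 2 = d"
begin

text \<open>The norm of the residue class of \<open>f\<close> modulo X^2 - d. The root
  \<open>s\<close> may lie outside the prime field, in which case \<open>- s\<close> is its
  conjugate.\<close>

definition nrm :: "'k poly \<Rightarrow> 'k" where
  "nrm f = poly f s * poly f (- s)"

lemma nrm_mult: "nrm (f * g) = nrm f * nrm g"
  by (simp add: nrm_def)

text \<open>\<open>s ^ p\<close> is again a square root of \<open>d\<close>. As Frobenius preserves
  the pair \<open>s\<close>, \<open>- s\<close>, the norm of a polynomial over the prime field lies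
  in that field.\<close>

lemma s_frob: "s ^ p = s \<or> s ^ p = - s"
proof -
  have "(s ^ p) ^ 2 = (s ^ 2) ^ p" by (simp add: mult.commute flip: power_mult)
  also have "\<dots> = s ^ 2" using d_Fp by (simp add: s_square Fq_def)
  finally show ?thesis by (simp only: power2_eq_iff)
qed

lemma nrm_in_Fp:
  assumes "f \<in> Fpoly"
  shows "nrm f \<in> Fp"
proof -
  have "poly f y ^ p = poly f (y ^ p)" for y
    using frob_poly[of f y 1] assms by (simp add: Fpoly_frobp frobp_def)
  hence "nrm f ^ p = poly f (s ^ p) * poly f (- (s ^ p))"
    using frob_uminus[of s 1] by (simp add: nrm_def power_mult_distrib)
  also have "\<dots> = nrm f" using s_frob by (auto simp: nrm_def)
  finally show ?thesis by (simp add: Fq_def)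
qed

lemma nrm_M:
  shows "nrm (M k x) = (\<Prod>i<k. (x ^ 2 - d) ^ p ^ i)"
proof -
  have "nrm (M k x) = (\<Prod>i<k. (s - x ^ p ^ i) * (- s - x ^ p ^ i))"
    by (simp add: nrm_def M_def poly_prod prod.distrib add.commute)
  also have "\<dots> = (\<Prod>i<k. (x ^ 2 - d) ^ p ^ i)"
  proof (intro prod.cong refl)
    fix i
    have "(x ^ 2 - d) ^ p ^ i = (x ^ p ^ i) ^ 2 - s ^ 2"
      using frob_p[OF d_Fp] by (simp add: frob_diff s_square mult.commute flip: power_mult)
    thus "(s - x ^ p ^ i) * (- s - x ^ p ^ i) = (x ^ 2 - d) ^ p ^ i"
      by (simp add: algebra_simps power2_eq_square)
  qed
  finally show ?thesis .
qed

text \<open>Completely multiplicative on monic polynomials over the prime field; its values at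
  \<open>M k x\<close> are the terms of \<open>T a k\<close>, which links the L-function to the
  character sums.\<close>

definition Lam :: "int \<Rightarrow> 'k poly \<Rightarrow> complex" where
  "Lam a f = psi a (trc f) * of_real (chi p (nrm f))"

definition lcoeff :: "int \<Rightarrow> nat \<Rightarrow> complex" where
  "lcoeff a m = (\<Sum>f\<in>Mon m. Lam a f)"

definition T :: "int \<Rightarrow> nat \<Rightarrow> complex" where
  "T a k = (\<Sum>x\<in>F k. psi a (Tr k x) * of_real (chi (p ^ k) (x ^ 2 - d)))"

lemma Lam_mult:
  assumes "f \<in> Mon m" "g \<in> Mon n"
  shows "Lam a (f * g) = Lam a f * Lam a g"
  using assms
  unfolding Mon_def mem_Collect_eq Lam_def nrm_mult
  by (subst trc_mult) (auto simp: psi_add trc_in_Fp chi_mult_p nrm_in_Fp)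

lemma Lam_M:
  assumes "k > 0"
  shows "Lam a (M k x) = psi a (Tr k x) * of_real (chi (p ^ k) (x ^ 2 - d))"
  using assms by (simp add: Lam_def trc_M nrm_M chi_prod_frob)

text \<open>Newton's identities for the generating function of the \<open>lcoeff a m\<close>: both sides
  count the pairs of a monic $f$ of degree $m$ and a prime power dividing it.\<close>
lemma newton_identity:
  "of_nat m * lcoeff a m = (\<Sum>k=1..m. T a k * lcoeff a (m - k))"
proof -
  have fin: "finite (F k)" if "k \<ge> 1" for k using finite_Fq[of k] that by simp
  have "of_nat m * lcoeff a m = (\<Sum>f\<in>Mon m. \<Sum>k=1..m. of_nat (card {x \<in> F k. M k x dvd f}) * Lam a f)"
    unfolding lcoeff_def sum_distrib_left sum_distrib_right [symmetric] of_nat_sum [symmetric]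
    by (intro sum.cong refl) (simp only: sum_card_M_dvd)
  also have "\<dots> = (\<Sum>k=1..m. \<Sum>f\<in>Mon m. of_nat (card {x \<in> F k. M k x dvd f}) * Lam a f)"
    by (rule sum.swap)
  also have "\<dots> = (\<Sum>k=1..m. T a k * lcoeff a (m - k))"
  proof (intro sum.cong refl)
    fix k assume k: "k \<in> {1..m}"
    have "(\<Sum>f\<in>Mon m. of_nat (card {x \<in> F k. M k x dvd f}) * Lam a f)
      = (\<Sum>f\<in>Mon m. \<Sum>x\<in>{x \<in> F k. M k x dvd f}. Lam a f)" by simp
    also have "\<dots> = (\<Sum>x\<in>F k. \<Sum>f\<in>{f \<in> Mon m. M k x dvd f}. Lam a f)"
      by (rule sum.swap_restrict) (use fin k finite_Mon in auto)
    also have "\<dots> = (\<Sum>x\<in>F k. Lam a (M k x) * lcoeff a (m - k))"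
    proof (intro sum.cong refl)
      fix x assume x: "x \<in> F k"
      note Mx = M_in_Mon[OF x]
      have "bij_betw (\<lambda>g. M k x * g) (Mon (m - k)) {f \<in> Mon m. M k x dvd f}"
        unfolding bij_betw_def
      proof (intro conjI equalityI subsetI inj_onI)
        fix f assume "f \<in> {f \<in> Mon m. M k x dvd f}"
        then obtain g where "f = M k x * g" "M k x * g \<in> Mon m" by (auto elim: dvdE)
        thus "f \<in> (\<lambda>g. M k x * g) ` Mon (m - k)" using Mon_cancel(2)[OF _ Mx] by blast
      next
        fix f assume "f \<in> (\<lambda>g. M k x * g) ` Mon (m - k)"
        thus "f \<in> {f \<in> Mon m. M k x dvd f}" using Mon_mult[OF Mx, of _ "m - k"] k by auto
      qed auto
      hence "(\<Sum>f\<in>{f \<in> Mon m. M k x dvd f}. Lam a f) = (\<Sum>g\<in>Mon (m - k). Lam a (M k x * g))"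
        by (rule sum.reindex_bij_betw [symmetric])
      also have "\<dots> = Lam a (M k x) * lcoeff a (m - k)"
        unfolding lcoeff_def sum_distrib_left by (intro sum.cong refl Lam_mult[OF Mx])
      finally show "(\<Sum>f\<in>{f \<in> Mon m. M k x dvd f}. Lam a f) = Lam a (M k x) * lcoeff a (m - k)" .
    qed
    also have "\<dots> = T a k * lcoeff a (m - k)"
      unfolding T_def sum_distrib_right using k by (intro sum.cong refl) (simp add: Lam_M)
    finally show "(\<Sum>f\<in>Mon m. of_nat (card {x \<in> F k. M k x dvd f}) * Lam a f) = T a k * lcoeff a (m - k)" .
  qed
  finally show ?thesis .
qed

section \<open>The coefficients of the L-function and the recurrence they impose on the sums\<close>

lemma lcoeff_0: "lcoeff a 0 = 1"
proof -
  have "Mon 0 = {1}"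
    by (auto simp: Mon_def elim!: degree_eq_zeroE)
  thus ?thesis by (simp add: lcoeff_def Lam_def nrm_def)
qed

text \<open>X^2 - bX + c has norm (c+d)^2 - d b^2. For fixed \<open>b \<noteq> 0\<close> the sum
  over \<open>c\<close> is a hyperbola sum with value -1; for \<open>b = 0\<close> it counts nonzero
  squares and is p - 1. The leftover sum of \<open>psi a\<close> vanishes.\<close>

lemma lcoeff_2:
  assumes "\<not> int p dvd a"
  shows "lcoeff a 2 = of_nat p"
proof -
  have "bij_betw (\<lambda>(b, c). [:c, - b, 1:]) (Fp \<times> Fp) (Mon 2)"
    unfolding bij_betw_def
  proof (intro conjI equalityI subsetI inj_onI)
    fix f assume f: "f \<in> Mon 2"
    hence "f = [:coeff f 0, - (- coeff f 1), 1:]"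
      by (intro poly_eqI) (auto simp: Mon_def coeff_pCons eval_nat_numeral coeff_eq_0 split: nat.splits)
    moreover have "coeff f 0 \<in> Fp" "- coeff f 1 \<in> Fp"
      using f by (auto simp: Mon_def Fpoly_def intro: Fp_uminus)
    ultimately show "f \<in> (\<lambda>(b, c). [:c, - b, 1:]) ` (Fp \<times> Fp)" by force
  next
    fix f assume "f \<in> (\<lambda>(b, c). [:c, - b, 1:]) ` (Fp \<times> Fp)"
    thus "f \<in> Mon 2"  by (auto simp: Mon_def Fpoly_pCons Fp_uminus)
  qed auto
  hence "lcoeff a 2 = (\<Sum>(b, c)\<in>Fp \<times> Fp. Lam a [:c, - b, 1:])"
    unfolding lcoeff_def by (subst sum.reindex_bij_betw [symmetric]) (auto simp: case_prod_unfold)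
  also have "\<dots> = (\<Sum>b\<in>Fp. \<Sum>c\<in>Fp. Lam a [:c, - b, 1:])"
    by (rule sum.cartesian_product [symmetric])
  also have "\<dots> = (\<Sum>b\<in>Fp. psi a b * (if b = 0 then of_nat p - 1 else - 1))"
  proof (intro sum.cong refl)
    fix b assume b: "b \<in> Fp"
    have nrm: "nrm [:c, - b, 1:] = (c + d) ^ 2 - d * b ^ 2" for c
      by (simp add: nrm_def algebra_simps power2_eq_square flip: s_square)
    have "(\<Sum>c\<in>Fp. chi p ((c + d) ^ 2 - d * b ^ 2)) = (\<Sum>c\<in>Fp. chi p (c ^ 2 - d * b ^ 2))"
      by (rule sum.reindex_bij_witness[of _ "\<lambda>c. c - d" "\<lambda>c. c + d"]) (auto intro: d_Fp Fp_add Fp_diff)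
    also have "\<dots> = (if b = 0 then real p - 1 else - 1)"
    proof (cases "b = 0")
      case True
      have "(\<Sum>c\<in>Fp. chi p (c ^ 2 - d * b ^ 2)) = (\<Sum>c\<in>Fp. if c = 0 then 0 else 1)"
        by (intro sum.cong refl) (use True chi_square[where n = 1] in \<open>auto\<close>)
      also have "\<dots> = (\<Sum>c\<in>Fp - {0}. 1)"
        by (intro sum.mono_neutral_cong_right) auto
      also have "\<dots> = real (p - 1)" by (simp add: card_Diff_singleton card_Fp)
      finally show ?thesis using True p_pos by (simp add: of_nat_diff)
    next
      case False
      thus ?thesis using sum_chi_hyperbola[of 1 "d * b ^ 2"] d_nz d_Fp b
        by (simp add: Fq_mult Fq_power)
    qed
    finally have "(\<Sum>c\<in>Fp. chi p ((c + d) ^ 2 - d * b ^ 2)) = (if b = 0 then real p - 1 else - 1)" .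
    moreover have "Lam a [:c, - b, 1:] = psi a b * of_real (chi p ((c + d) ^ 2 - d * b ^ 2))" for c
      unfolding Lam_def nrm by (simp add: trc_def coeff_reflect_poly)
    ultimately have "(\<Sum>c\<in>Fp. Lam a [:c, - b, 1:]) = psi a b * of_real (if b = 0 then real p - 1 else - 1)"
      by (simp only: sum_distrib_left [symmetric] of_real_sum [symmetric])
    thus "(\<Sum>c\<in>Fp. Lam a [:c, - b, 1:]) = psi a b * (if b = 0 then of_nat p - 1 else - 1)"
      by simp
  qed
  also have "\<dots> = (\<Sum>b\<in>Fp. (if b = 0 then of_nat p else 0) - psi a b)"
    by (intro sum.cong refl) auto
  also have "\<dots> = of_nat p" using assms by (simp add: sum_subtractf sum_psi)
  finally show ?thesis .
qed

text \<open>Adding $X^{m-3} (X^2 - d)$ changes the trace of a polynomial but not its norm.\<close>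
lemma lcoeff_eq_0:
  assumes a: "\<not> int p dvd a" and m: "m \<ge> 3"
  shows "lcoeff a m = 0"
proof -
  define g :: "'k poly" where "g = monom 1 (m - 3) * [:- d, 0, 1:]"
  have deg: "degree g = m - 1"
    unfolding g_def using m by (subst degree_mult_eq) (auto simp: degree_monom_eq)
  have co: "coeff g (m - 1) = 1"
  proof -
    have "lead_coeff g = 1" unfolding g_def lead_coeff_mult by (simp add: degree_monom_eq)
    thus ?thesis by (simp add: deg)
  qed
  have gF: "g \<in> Fpoly"
  proof -
    have "monom 1 (m - 3) \<in> Fpoly" by (auto simp: Fpoly_def)
    thus ?thesis unfolding g_def using d_Fp by (intro Fpoly_mult) (auto simp: Fpoly_pCons Fp_uminus)
  qed
  have pg: "poly g s = 0" "poly g (- s) = 0"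
    using s_square by (simp_all add: g_def power2_eq_square)
  have deg': "degree (f + g) = m" "degree (f - g) = m" if "f \<in> Mon m" for f
    using that deg m degree_add_eq_left[of g f] degree_add_eq_left[of "- g" f]
    by (auto simp: Mon_def)
  have mon: "f + g \<in> Mon m" "f - g \<in> Mon m" if "f \<in> Mon m" for f
    using deg'[OF that] deg m that gF by (auto simp: Mon_def Fpoly_add Fpoly_diff coeff_eq_0)
  have L: "Lam a (f + g) = psi a (- 1) * Lam a f" if "f \<in> Mon m" for f
  proof -
    have "trc (f + g) = trc f + (- 1)"
      using that deg'(1)[OF that] m co by (simp add: trc_def coeff_reflect_poly Mon_def)
    hence "psi a (trc (f + g)) = psi a (trc f) * psi a (- 1)"
      using that Fp_of_int[of "- 1"] by (simp only:) (intro psi_add, auto simp: Mon_def trc_in_Fp)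
    thus ?thesis by (simp add: Lam_def nrm_def pg)
  qed
  have "lcoeff a m = (\<Sum>f\<in>Mon m. Lam a (f + g))"
    unfolding lcoeff_def
    by (rule sum.reindex_bij_witness[of _ "\<lambda>f. f + g" "\<lambda>f. f - g"]) (auto simp: mon)
  also have "\<dots> = psi a (- 1) * lcoeff a m"
    unfolding lcoeff_def sum_distrib_left by (intro sum.cong refl L)
  finally have "lcoeff a m * (psi a (- 1) - 1) = 0" by (simp add: algebra_simps)
  thus ?thesis using psi_minus_1[OF a] by simp
qed

text \<open>The substitution of \<open>- x\<close> for \<open>x\<close> conjugates the additive
  character and leaves x^2 - d unchanged.\<close>

lemma T_real: "T a k \<in> \<real>"
proof -
  have "cnj (T a k) = (\<Sum>x\<in>F k. cnj (psi a (Tr k x)) * of_real (chi (p ^ k) (x ^ 2 - d)))"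
    by (simp add: T_def)
  also have "\<dots> = (\<Sum>x\<in>F k. psi a (Tr k (- x)) * of_real (chi (p ^ k) ((- x) ^ 2 - d)))"
    by (intro sum.cong refl) (simp add: Tr_uminus psi_uminus Tr_in_Fp)
  also have "\<dots> = T a k"
    unfolding T_def by (rule sum.reindex_bij_witness[of _ uminus uminus]) (auto intro: Fq_uminus)
  finally show ?thesis by (simp add: complex_cnj_cancel_iff Reals_cnj_iff)
qed

lemma lcoeff_1: "lcoeff a 1 = T a 1"
  using newton_identity[of 1 a] by (simp add: lcoeff_0)

lemmas lcoeff_Suc_0 = lcoeff_1[unfolded One_nat_def]

lemma T_2:
  assumes "\<not> int p dvd a"
  shows "T a 2 = 2 * of_nat p - T a 1 ^ 2"
proof -
  have "2 * lcoeff a 2 = T a 1 * lcoeff a 1 + T a 2"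
    using newton_identity[of 2 a] by (simp add: numeral_2_eq_2 lcoeff_0)
  thus ?thesis using lcoeff_2[OF assms] by (simp add: lcoeff_Suc_0 power2_eq_square)
qed

text \<open>In Newton's identity for \<open>m = n + 3\<close> the left side vanishes, and only the
  terms with \<open>lcoeff\<close> of index 0, 1 or 2 survive on the right.\<close>

lemma T_rec:
  assumes "\<not> int p dvd a"
  shows "T a (n + 3) = - T a 1 * T a (n + 2) - of_nat p * T a (n + 1)"
proof -
  have "0 = (\<Sum>k=1..n+3. T a k * lcoeff a (n + 3 - k))"
    using newton_identity[of "n + 3" a] lcoeff_eq_0[OF assms] by simp
  also have "\<dots> = (\<Sum>k\<in>{n+1, n+2, n+3}. T a k * lcoeff a (n + 3 - k))"
    by (rule sum.mono_neutral_right) (auto intro!: lcoeff_eq_0 assms)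
  also have "\<dots> = T a (n + 1) * lcoeff a 2 + T a (n + 2) * lcoeff a 1 + T a (n + 3)"
    by (simp add: lcoeff_0 add.assoc)
  finally show ?thesis
    by (simp add: lcoeff_2[OF assms] lcoeff_Suc_0 algebra_simps eq_neg_iff_add_eq_0)
qed

end

subsection \<open>Stepanov's bound\<close>

context fp_closure
begin

section \<open>Polynomials of bounded degree and their Frobenius powers\<close>

definition P :: "nat \<Rightarrow> 'k poly set" where
  "P n = {f \<in> Fpoly. \<forall>i\<ge>n. coeff f i = 0}"

lemma P_degree: "f \<in> P n \<Longrightarrow> f \<noteq> 0 \<Longrightarrow> degree f < n"
  by (metis (mono_tags, lifting) P_def leading_coeff_0_iff linorder_not_less mem_Collect_eq)

lemma PI: "f \<in> Fpoly \<Longrightarrow> f = 0 \<or> degree f < n \<Longrightarrow> f \<in> P n"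
  by (auto simp: P_def intro: coeff_eq_0)

lemma P_Fpoly: "f \<in> P n \<Longrightarrow> f \<in> Fpoly"
  by (simp add: P_def)

lemma P_mono: "f \<in> P m \<Longrightarrow> m \<le> n \<Longrightarrow> f \<in> P n"
  by (auto simp: P_def)

lemma P_diff: "f \<in> P n \<Longrightarrow> g \<in> P n \<Longrightarrow> f - g \<in> P n"
  by (auto simp: P_def Fpoly_diff)

lemma Fpoly_sum: "(\<And>i. i \<in> A \<Longrightarrow> f i \<in> Fpoly) \<Longrightarrow> sum f A \<in> Fpoly"
  by (induction A rule: infinite_finite_induct) (auto intro: Fpoly_add)

lemma Fpoly_power: "f \<in> Fpoly \<Longrightarrow> f ^ n \<in> Fpoly"
  by (induction n) (auto intro: Fpoly_mult)

lemma Fpoly_monom: "monom 1 n \<in> Fpoly"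
  by (auto simp: Fpoly_def)

lemma P_sum: "(\<And>i. i \<in> A \<Longrightarrow> f i \<in> P n) \<Longrightarrow> sum f A \<in> P n"
  by (auto simp: P_def Fpoly_sum coeff_sum)

lemma P_mult:
  assumes "f \<in> P m" "g \<in> Fpoly" "degree g \<le> n"
  shows "f * g \<in> P (m + n)"
proof (rule PI)
  show "f * g \<in> Fpoly" using assms by (auto intro: Fpoly_mult P_Fpoly)
  show "f * g = 0 \<or> degree (f * g) < m + n"
    using P_degree[OF assms(1)] degree_mult_le[of f g] assms(3) by fastforce
qed

lemma pcompose_monom_in_P:
  assumes "f \<in> P (Suc n)"
  shows "pcompose f (monom 1 B) \<in> P (Suc (n * B))"
proof (rule PI)
  have "f \<circ>\<^sub>p monom 1 B \<in> Fpoly" if "f \<in> Fpoly" for f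
    using that
  proof (induction f)
    case (pCons a f)
    thus ?case by (auto simp: pcompose_pCons Fpoly_pCons intro!: Fpoly_add Fpoly_mult Fpoly_monom)
  qed simp
  thus "f \<circ>\<^sub>p monom 1 B \<in> Fpoly" using assms P_Fpoly by blast
  have "degree f \<le> n" using P_degree[OF assms] by (cases "f = 0") auto
  hence "degree (f \<circ>\<^sub>p monom 1 B) \<le> n * B"
    by (simp add: degree_pcompose degree_monom_eq)
  thus "f \<circ>\<^sub>p monom 1 B = 0 \<or> degree (f \<circ>\<^sub>p monom 1 B) < Suc (n * B)" by simp
qed

lemma card_P: "card (P n) = p ^ n" and finite_P: "finite (P n)"
proof (induction n)
  case 0
  have "P 0 = {0}" by (auto simp: P_def poly_eq_iff)
  thus "card (P 0) = p ^ 0" "finite (P 0)" by auto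
next
  case (Suc n)
  have eq: "P (Suc n) = (\<lambda>(c, f). pCons c f) ` (Fp \<times> P n)"
  proof (intro equalityI subsetI)
    fix f assume f: "f \<in> P (Suc n)"
    obtain c g where "f = pCons c g" by (cases f)
    moreover from this f have "c \<in> Fp" "g \<in> P n"
      by (auto simp: P_def Fpoly_pCons coeff_pCons split: nat.splits)
    ultimately show "f \<in> (\<lambda>(c, f). pCons c f) ` (Fp \<times> P n)" by auto
  qed (auto simp: P_def Fpoly_pCons coeff_pCons split: nat.splits)
  have "inj_on (\<lambda>(c, f). pCons c f) (Fp \<times> P n)" by (auto simp: inj_on_def)
  thus "card (P (Suc n)) = p ^ Suc n" "finite (P (Suc n))"
    unfolding eq using Suc by (simp_all add: card_image card_cartesian_product card_Fp)
qed

lemma Fpoly_eval_frob: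
  assumes "f \<in> Fpoly"
  shows "poly f (x :: 'k) ^ p ^ n = poly f (x ^ p ^ n)"
proof -
  have "map_poly (\<lambda>c. c ^ p ^ n) f = f"
    using assms frob_p by (intro poly_eqI) (auto simp: coeff_map_poly power_0_left Fpoly_def)
  thus ?thesis using frob_poly[of f x n] by simp
qed

text \<open>Over the prime field f(X)^q = f(X^q), so modulo X^q only the constant term is left. This
  lets \<open>f ^ B\<close> be replaced by a constant in the proof that the auxiliary polynomial is
  nonzero.\<close>

lemma Fpoly_power_frob_dvd:
  assumes "f \<in> Fpoly"
  shows "monom 1 (p ^ n) dvd f ^ p ^ n - [:poly f 0:]"
proof -
  obtain c g where f: "f = pCons c g" by (cases f)
  have "f = [:c:] + monom 1 1 * g" by (simp add: f monom_altdef)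
  hence "f ^ p ^ n = [:c:] ^ p ^ n + (monom 1 1 * g) ^ p ^ n"
    using freshmans_dream'[where ?'a = "'k poly" and m = "p ^ n" and n = n] prime_char char_K
    by simp
  also have "[:c:] ^ p ^ n = [:c:]"
    using assms frob_p[of c n] by (simp add: f Fpoly_pCons poly_const_pow)
  finally have "f ^ p ^ n - [:poly f 0:] = monom 1 (p ^ n) * g ^ p ^ n"
    by (simp add: f power_mult_distrib monom_power)
  thus ?thesis by simp
qed

text \<open>Comparing orders of vanishing at a root of the squarefree polynomial $f$.\<close>
lemma square_eq_squarefree_mult:
  fixes f u v :: "'k poly"
  assumes "rsquarefree f" "degree f > 0" "c \<noteq> 0" "u ^ 2 = smult c (v ^ 2 * f)"
  shows "u = 0" "v = 0"
proof -
  have f: "f \<noteq> 0" using assms(2) by auto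
  obtain a where a: "poly f a = 0" using alg_closed_imp_poly_has_root[OF assms(2)] by blast
  have ord: "order a f = 1" using rsquarefree_root_order[OF assms(1) a f] .
  have "u = 0 \<and> v = 0"
  proof (cases "u = 0 \<or> v = 0")
    case True
    thus ?thesis using assms(3,4) f by auto
  next
    case False
    hence "order a (u ^ 2) = 2 * order a u"
      by (simp add: power2_eq_square order_mult)
    moreover have "order a (smult c (v ^ 2 * f)) = 2 * order a v + 1"
      using False f assms(3) ord by (simp add: power2_eq_square order_mult order_smult)
    ultimately have "2 * order a u = 2 * order a v + 1" using assms(4) by simp
    thus ?thesis by presburger
  qed
  thus "u = 0" "v = 0" by auto
qed

end

text \<open>The field under study is \<open>F (2 * m)\<close> with \<open>B ^ 2\<close> elements.
  The choice of \<open>h\<close> makes f^(2h) = f * f^B and h * B = (B^2 - 1)/2 + h, and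
  \<open>h > e\<close> leaves room for the coefficients \<open>s j\<close> below.\<close>

locale stepanov = fp_closure p K for p and K :: "'k::alg_closed_field itself" +
  fixes f :: "'k poly" and e m B h :: nat
  assumes f_Fpoly: "f \<in> Fpoly" and f_0: "poly f 0 \<noteq> 0" and f_rsquarefree: "rsquarefree f"
    and degree_f: "degree f = 2 * e" and e_pos: "e > 0"
    and B_def: "B = p ^ m" and h_def: "2 * h = B + 1" and h_gt: "h > e"
begin

text \<open>The auxiliary polynomial, with unknown coefficient polynomials \<open>r j\<close> and
  \<open>s j\<close>.\<close>

definition Theta :: "(nat \<Rightarrow> 'k poly) \<Rightarrow> (nat \<Rightarrow> 'k poly) \<Rightarrow> 'k poly" where
  "Theta r s = (\<Sum>j<h+e. (r j + s j * f ^ h) * monom 1 (j * B))"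

text \<open>What the \<open>B\<close>-th power of \<open>Theta\<close> becomes at points of
  \<open>F (2 * m)\<close> where \<open>f\<close> takes a nonsquare value: x^(B^2) reduces to x and
  f^(hB) to -f^h. Its vanishing is a linear condition on the unknowns.\<close>

definition Psi :: "(nat \<Rightarrow> 'k poly) \<Rightarrow> (nat \<Rightarrow> 'k poly) \<Rightarrow> 'k poly" where
  "Psi r s = (\<Sum>j<h+e. (pcompose (r j) (monom 1 B) - pcompose (s j) (monom 1 B) * f ^ h) * monom 1 j)"

lemma B_h: "B = 2 * h - 1" "h > 0"
  using h_def e_pos h_gt by auto

lemma degree_f_power: "degree (f ^ n) = 2 * e * n"
  using f_0 degree_f by (subst degree_power_eq) auto

text \<open>Bounding \<open>s j\<close> by \<open>h - e\<close> instead of \<open>h\<close> balances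
  the two halves: f^h adds 2eh = e(B+1) to the degree, so both stay below (h-1)B + e + 1.\<close>

lemma Psi_in_P:
  assumes "\<And>j. j < h + e \<Longrightarrow> r j \<in> P h" "\<And>j. j < h + e \<Longrightarrow> s j \<in> P (h - e)"
  shows "Psi r s \<in> P ((h - 1) * B + e + (h + e))"
  unfolding Psi_def
proof (rule P_sum)
  fix j assume "j \<in> {..<h + e}"
  hence j: "j < h + e" by simp
  have "r j \<in> P (Suc (h - 1))" using assms(1)[OF j] B_h by simp
  hence "pcompose (r j) (monom 1 B) \<in> P (Suc ((h - 1) * B))" by (rule pcompose_monom_in_P)
  hence 1: "pcompose (r j) (monom 1 B) \<in> P ((h - 1) * B + e + 1)" by (rule P_mono) simp
  have "Suc (h - e - 1) = h - e" using h_gt by simp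
  hence "s j \<in> P (Suc (h - e - 1))" using assms(2)[OF j] by (simp only:)
  hence "pcompose (s j) (monom 1 B) \<in> P (Suc ((h - e - 1) * B))" by (rule pcompose_monom_in_P)
  hence "pcompose (s j) (monom 1 B) * f ^ h \<in> P (Suc ((h - e - 1) * B) + 2 * e * h)"
    by (rule P_mult) (simp_all add: Fpoly_power f_Fpoly degree_f_power)
  moreover have "(h - e - 1) * B + 2 * e * h = (h - 1) * B + e"
  proof -
    obtain t where t: "h = Suc (e + t)" using h_gt less_iff_Suc_add by auto
    have "2 * e * h = e * (B + 1)" unfolding h_def [symmetric] by simp
    thus ?thesis by (simp add: t algebra_simps)
  qed
  ultimately have 2: "pcompose (s j) (monom 1 B) * f ^ h \<in> P ((h - 1) * B + e + 1)" by simp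
  have "(pcompose (r j) (monom 1 B) - pcompose (s j) (monom 1 B) * f ^ h) * monom 1 j
      \<in> P ((h - 1) * B + e + 1 + j)"
    by (rule P_mult[OF P_diff[OF 1 2]]) (auto simp: Fpoly_monom degree_monom_le)
  thus "(pcompose (r j) (monom 1 B) - pcompose (s j) (monom 1 B) * f ^ h) * monom 1 j
      \<in> P ((h - 1) * B + e + (h + e))"
    by (rule P_mono) (use j in simp)
qed

text \<open>With h = e + t + 1 the right side exceeds the left by (t+1)(e+2) - 1, which is positive
  as e > 0 in this locale.\<close>

lemma unknowns_gt_equations:
  "(h - 1) * B + e + (h + e) < (h + (h - e)) * (h + e)"
proof -
  obtain t where t: "h = Suc (e + t)" using h_gt less_iff_Suc_add by auto
  have "B = 2 * (e + t) + 1" using B_h by (simp add: t)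
  thus ?thesis by (simp add: t algebra_simps)
qed

text \<open>Pigeonhole in place of linear algebra: there are more coefficient families than possible
  values of \<open>Psi\<close>, and the difference of two families with equal value is a nonzero
  solution.\<close>

lemma exists_auxiliary:
  obtains r s where "\<forall>j<h+e. r j \<in> P h" "\<forall>j<h+e. s j \<in> P (h - e)"
    "Psi r s = 0" "\<exists>j<h+e. r j \<noteq> 0 \<or> s j \<noteq> 0"
proof -
  let ?X = "{..<h + e} \<rightarrow>\<^sub>E P h \<times> P (h - e)"
  let ?G = "\<lambda>t. Psi (\<lambda>j. fst (t j)) (\<lambda>j. snd (t j))"
  have X: "fst (t j) \<in> P h" "snd (t j) \<in> P (h - e)" if "t \<in> ?X" "j < h + e" for t j
    using that by (auto simp: PiE_iff mem_Times_iff)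
  have "card ?X = (p ^ h * p ^ (h - e)) ^ (h + e)"
    by (simp add: card_PiE card_cartesian_product card_P)
  also have "\<dots> = p ^ ((h + (h - e)) * (h + e))"
    by (simp only: power_add [symmetric] power_mult [symmetric])
  finally have cX: "card ?X = p ^ ((h + (h - e)) * (h + e))" .
  have sub: "?G ` ?X \<subseteq> P ((h - 1) * B + e + (h + e))"
    using X by (intro image_subsetI Psi_in_P) auto
  have "\<not> inj_on ?G ?X"
  proof
    assume "inj_on ?G ?X"
    hence "card ?X \<le> p ^ ((h - 1) * B + e + (h + e))"
      using card_inj_on_le[OF _ sub finite_P] by (simp only: card_P)
    moreover have "p ^ ((h - 1) * B + e + (h + e)) < card ?X"
      unfolding cX using p_gt_2 by (intro power_strict_increasing unknowns_gt_equations) simp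
    ultimately show False by simp
  qed
  then obtain t t' where t: "t \<in> ?X" "t' \<in> ?X" "t \<noteq> t'" "?G t = ?G t'"
    unfolding inj_on_def by blast
  obtain j where j: "t j \<noteq> t' j" using t(3) by auto
  hence "j < h + e" using t(1,2) by (metis PiE_arb lessThan_iff)
  show thesis
  proof (rule that[of "\<lambda>j. fst (t j) - fst (t' j)" "\<lambda>j. snd (t j) - snd (t' j)"])
    have "?G t - ?G t' = Psi (\<lambda>j. fst (t j) - fst (t' j)) (\<lambda>j. snd (t j) - snd (t' j))"
      unfolding Psi_def sum_subtractf [symmetric]
      by (intro sum.cong refl) (simp add: pcompose_diff algebra_simps)
    thus "Psi (\<lambda>j. fst (t j) - fst (t' j)) (\<lambda>j. snd (t j) - snd (t' j)) = 0" using t(4) by simp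
    show "\<exists>j<h+e. fst (t j) - fst (t' j) \<noteq> 0 \<or> snd (t j) - snd (t' j) \<noteq> 0"
      using j \<open>j < h + e\<close> by (intro exI[of _ j]) (auto simp: prod_eq_iff)
  qed (use X t in \<open>auto intro: P_diff\<close>)
qed

text \<open>If the sum vanished, its lowest nonzero index \<open>k\<close> would give r + s f^h = 0
  modulo X^B, since all later terms carry a further factor X^B. After multiplication by a conjugate,
  this becomes an exact equation r^2 = f(0) s^2 f, impossible for squarefree
  \<open>f\<close>.\<close>

lemma Theta_nonzero:
  assumes r: "\<And>j. j < h + e \<Longrightarrow> r j \<in> P h" and s: "\<And>j. j < h + e \<Longrightarrow> s j \<in> P (h - e)"
    and nz: "\<exists>j<h+e. r j \<noteq> 0 \<or> s j \<noteq> 0"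
  shows "Theta r s \<noteq> 0"
proof
  assume "Theta r s = 0"
  define k where "k = (LEAST j. j < h + e \<and> (r j \<noteq> 0 \<or> s j \<noteq> 0))"
  have k: "k < h + e" "r k \<noteq> 0 \<or> s k \<noteq> 0"
    using LeastI_ex[OF nz] unfolding k_def by auto
  have less_k: "r j = 0 \<and> s j = 0" if "j < k" for j
    using not_less_Least[of j "\<lambda>j. j < h + e \<and> (r j \<noteq> 0 \<or> s j \<noteq> 0)"] that k(1) unfolding k_def by auto
  let ?g = "\<lambda>j. r j + s j * f ^ h"
  have eq: "Theta r s = ?g k * monom 1 (k * B) + (\<Sum>j\<in>{..<h+e} - {k}. ?g j * monom 1 (j * B))"
    unfolding Theta_def using k(1) by (subst sum.remove[of _ k]) auto
  have dv: "monom 1 (k * B + B) dvd (\<Sum>j\<in>{..<h+e} - {k}. ?g j * monom 1 (j * B))"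
  proof (rule dvd_sum)
    fix j assume j: "j \<in> {..<h+e} - {k}"
    show "monom 1 (k * B + B) dvd ?g j * monom 1 (j * B)"
    proof (cases "j < k")
      case True
      thus ?thesis using less_k by simp
    next
      case False
      hence "Suc k * B \<le> j * B" using j by (intro mult_le_mono1) auto
      hence "monom 1 (j * B) = monom 1 (k * B + B) * (monom 1 (j * B - (k * B + B)) :: 'k poly)"
        by (simp add: mult_monom)
      thus ?thesis by (metis dvd_mult dvd_triv_left)
    qed
  qed
  have "?g k * monom 1 (k * B) = - (\<Sum>j\<in>{..<h+e} - {k}. ?g j * monom 1 (j * B))"
    using eq \<open>Theta r s = 0\<close> unfolding eq_neg_iff_add_eq_0 by (simp only:)
  hence "monom 1 (k * B + B) dvd ?g k * monom 1 (k * B)" using dv by (simp only: dvd_minus_iff)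
  also have "monom 1 (k * B + B) = monom 1 B * (monom 1 (k * B) :: 'k poly)"
    by (simp add: mult_monom add.commute)
  finally have "monom 1 B dvd ?g k" by simp
  \<comment> \<open>The conjugate factor produces f^(2h) = f * f^B, where f^B is constant modulo
    X^B.\<close>
  hence "monom 1 B dvd ?g k * (r k - s k * f ^ h)" by (rule dvd_mult2)
  also have "?g k * (r k - s k * f ^ h) = r k ^ 2 - s k ^ 2 * f ^ (2 * h)"
    unfolding mult_2 power_add by (simp add: algebra_simps power2_eq_square)
  also have "\<dots> = r k ^ 2 - s k ^ 2 * f * f ^ p ^ m"
    unfolding h_def B_def by (simp add: mult_ac)
  finally have "monom 1 B dvd r k ^ 2 - s k ^ 2 * f * f ^ p ^ m" .
  moreover have "monom 1 B dvd s k ^ 2 * f * (f ^ p ^ m - [:poly f 0:])"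
    unfolding B_def by (intro dvd_mult Fpoly_power_frob_dvd f_Fpoly)
  ultimately have "monom 1 B dvd (r k ^ 2 - s k ^ 2 * f * f ^ p ^ m) + s k ^ 2 * f * (f ^ p ^ m - [:poly f 0:])"
    by (rule dvd_add)
  also have "\<dots> = r k ^ 2 - smult (poly f 0) (s k ^ 2 * f)"
    by (simp add: algebra_simps)
  finally have dvd: "monom 1 B dvd r k ^ 2 - smult (poly f 0) (s k ^ 2 * f)" .
  \<comment> \<open>Both terms have degree at most 2(h-1) = B - 1, so divisibility by X^B forces
    equality.\<close>
  have "degree (r k ^ 2) < B"
  proof (cases "r k = 0")
    case False
    hence "degree (r k) < h" using P_degree r[OF k(1)] by blast
    moreover have "degree (r k ^ 2) = 2 * degree (r k)" using False by (simp add: degree_power_eq)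
    ultimately show ?thesis using B_h by simp
  qed (use B_h in auto)
  moreover have "degree (smult (poly f 0) (s k ^ 2 * f)) < B"
  proof (cases "s k = 0")
    case False
    hence "degree (s k) < h - e" using P_degree s[OF k(1)] by blast
    moreover have "degree (s k ^ 2 * f) = 2 * degree (s k) + 2 * e"
      using False f_0 degree_f by (subst degree_mult_eq) (auto simp: degree_power_eq)
    ultimately show ?thesis using B_h f_0 by simp
  qed (use B_h in auto)
  ultimately have "degree (r k ^ 2 - smult (poly f 0) (s k ^ 2 * f)) < B"
    by (rule degree_diff_less)
  hence "r k ^ 2 - smult (poly f 0) (s k ^ 2 * f) = 0"
    using dvd_imp_degree_le[OF dvd] by (auto simp: degree_monom_eq)
  hence "r k ^ 2 = smult (poly f 0) (s k ^ 2 * f)" by simp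
  from square_eq_squarefree_mult[OF f_rsquarefree _ f_0 this] k(2) degree_f e_pos show False by auto
qed

text \<open>The \<open>B\<close>-th power of the value is computed termwise by Frobenius and equals
  the value of \<open>Psi\<close>, which is zero.\<close>

lemma Theta_root:
  assumes r: "\<And>j. j < h + e \<Longrightarrow> r j \<in> P h" and s: "\<And>j. j < h + e \<Longrightarrow> s j \<in> P (h - e)"
    and Psi: "Psi r s = 0" and x: "x \<in> F (2 * m)" "poly f x ^ ((B ^ 2 - 1) div 2) = - 1"
  shows "poly (Theta r s) x = 0"
proof -
  have BB: "p ^ (2 * m) = B * B" by (simp add: B_def mult_2 power_add)
  \<comment> \<open>As h * B = (B^2 - 1)/2 + h, the assumed value -1 enters as a sign.\<close>
  have fx: "poly f x ^ (h * B) = - (poly f x ^ h)"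
  proof -
    have "h * B = (B ^ 2 - 1) div 2 + h"
    proof -
      obtain t where t: "h = Suc t" using B_h(2) gr0_implies_Suc by blast
      have "B = 2 * t + 1" using B_h by (simp add: t)
      thus ?thesis by (simp add: t power2_eq_square algebra_simps)
    qed
    thus ?thesis using x(2) by (simp add: power_add)
  qed
  have "poly (Theta r s) x = (\<Sum>j<h+e. (poly (r j) x + poly (s j) x * poly f x ^ h) * x ^ (j * B))"
    by (simp add: Theta_def poly_sum poly_monom)
  hence "poly (Theta r s) x ^ B = (\<Sum>j<h+e. (poly (r j) x + poly (s j) x * poly f x ^ h) * x ^ (j * B)) ^ p ^ m"
    by (simp only: B_def [symmetric])
  also have "\<dots> = (\<Sum>j<h+e. ((poly (r j) x + poly (s j) x * poly f x ^ h) * x ^ (j * B)) ^ p ^ m)"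
    by (rule frob_sum)
  also have "\<dots> = (\<Sum>j<h+e. (poly (r j) (x ^ B) - poly (s j) (x ^ B) * poly f x ^ h) * x ^ j)"
  proof (intro sum.cong refl)
    fix j assume "j \<in> {..<h+e}"
    hence j: "j < h + e" by simp
    have "(x ^ (j * B)) ^ B = (x ^ p ^ (2 * m)) ^ j"
      unfolding BB by (simp add: mult_ac flip: power_mult)
    hence "(x ^ (j * B)) ^ B = x ^ j" using x(1) by (simp add: Fq_def)
    moreover have "poly (r j) x ^ B = poly (r j) (x ^ B)" "poly (s j) x ^ B = poly (s j) (x ^ B)"
      using Fpoly_eval_frob[of _ x m] P_Fpoly r[OF j] s[OF j] by (auto simp: B_def)
    moreover have "(poly (s j) x * poly f x ^ h) ^ B = poly (s j) x ^ B * poly f x ^ (h * B)"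
      by (simp add: power_mult_distrib power_mult)
    ultimately show "((poly (r j) x + poly (s j) x * poly f x ^ h) * x ^ (j * B)) ^ p ^ m
        = (poly (r j) (x ^ B) - poly (s j) (x ^ B) * poly f x ^ h) * x ^ j"
      unfolding power_mult_distrib[of "_ + _"] frob_add unfolding B_def [symmetric] by (simp add: fx)
  qed
  also have "\<dots> = poly (Psi r s) x"
    by (simp add: Psi_def poly_sum poly_pcompose poly_monom)
  finally show ?thesis using Psi B_h by simp
qed

lemma degree_Theta_le:
  assumes r: "\<And>j. j < h + e \<Longrightarrow> r j \<in> P h" and s: "\<And>j. j < h + e \<Longrightarrow> s j \<in> P (h - e)"
  shows "degree (Theta r s) \<le> h + 2 * e * h + (h + e - 1) * B"
  unfolding Theta_def
proof (rule degree_sum_le)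
  fix j assume "j \<in> {..<h + e}"
  hence j: "j < h + e" by simp
  have "degree (r j) \<le> h" using P_degree[OF r[OF j]] by (cases "r j = 0") auto
  moreover have "degree (s j) \<le> h" using P_degree[OF s[OF j]] by (cases "s j = 0") auto
  hence "degree (s j * f ^ h) \<le> h + 2 * e * h"
    using degree_mult_le[of "s j" "f ^ h"] by (simp add: degree_f_power)
  ultimately have "degree (r j + s j * f ^ h) \<le> h + 2 * e * h"
    by (intro degree_add_le) auto
  moreover have "degree (monom 1 (j * B) :: 'k poly) \<le> (h + e - 1) * B"
    using j by (intro order_trans[OF degree_monom_le] mult_le_mono1) simp
  ultimately show "degree ((r j + s j * f ^ h) * monom 1 (j * B)) \<le> h + 2 * e * h + (h + e - 1) * B"
    by (intro order_trans[OF degree_mult_le] add_mono)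
qed simp

lemma card_nonsquare_values:
  "2 * card {x \<in> F (2 * m). poly f x ^ ((B ^ 2 - 1) div 2) = - 1} \<le> B ^ 2 + (6 * e + 2) * B"
proof -
  obtain r s where rs': "\<forall>j<h+e. r j \<in> P h" "\<forall>j<h+e. s j \<in> P (h - e)"
    and rs: "Psi r s = 0" "\<exists>j<h+e. r j \<noteq> 0 \<or> s j \<noteq> 0"
    by (rule exists_auxiliary)
  have r: "\<And>j. j < h + e \<Longrightarrow> r j \<in> P h" and s: "\<And>j. j < h + e \<Longrightarrow> s j \<in> P (h - e)"
    using rs' by auto
  have nz: "Theta r s \<noteq> 0" by (rule Theta_nonzero[OF r s rs(2)])
  have "card {x \<in> F (2 * m). poly f x ^ ((B ^ 2 - 1) div 2) = - 1} \<le> card {x. poly (Theta r s) x = 0}"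
    by (intro card_mono poly_roots_finite nz) (use Theta_root[OF r s rs(1)] in auto)
  also have "\<dots> \<le> degree (Theta r s)" by (rule card_poly_roots_bound[OF nz])
  also have "\<dots> \<le> h + 2 * e * h + (h + e - 1) * B" by (rule degree_Theta_le[OF r s])
  finally have "2 * card {x \<in> F (2 * m). poly f x ^ ((B ^ 2 - 1) div 2) = - 1}
      \<le> 2 * (h + 2 * e * h + (h + e - 1) * B)" by (intro mult_le_mono2)
  also have "\<dots> \<le> B ^ 2 + (6 * e + 2) * B"
  proof -
    obtain t where t: "h = Suc t" using B_h(2) gr0_implies_Suc by blast
    have "B = 2 * t + 1" using B_h by (simp add: t)
    thus ?thesis by (simp add: t power2_eq_square algebra_simps)
  qed
  finally show ?thesis .
qed

text \<open>On the field, \<open>chi\<close> is 1 minus the indicator of zeros minus twice the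
  indicator of nonsquare values, and the latter make up at most half of the field up to O(B). Only
  this one-sided bound is used later.\<close>

lemma sum_chi_lower_bound:
  assumes "m > 0"
  shows "(\<Sum>x\<in>F (2 * m). chi (p ^ (2 * m)) (poly f x)) \<ge> - real ((8 * e + 2) * B)"
proof -
  let ?F = "F (2 * m)"
  have q: "p ^ (2 * m) = B ^ 2" by (simp add: B_def mult.commute power_mult)
  have fin: "finite ?F" using assms by (intro finite_Fq) simp
  let ?A = "{x \<in> ?F. poly f x ^ ((B ^ 2 - 1) div 2) = - 1}"
  let ?Z = "{x \<in> ?F. poly f x = 0}"
  have fz: "f \<noteq> 0" using f_0 by auto
  have "chi (p ^ (2 * m)) (poly f x) \<ge> 1 - (if x \<in> ?Z then 1 else 0) - 2 * (if x \<in> ?A then 1 else 0)"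
    if x: "x \<in> ?F" for x
  proof -
    have "poly f x \<in> ?F"
      using Fpoly_eval_frob[OF f_Fpoly, of x "2 * m"] x by (simp add: Fq_def)
    from half_power_cases[OF this, unfolded q] show ?thesis
      using x by (auto simp: chi_def q [symmetric] simp del: One_nat_def)
  qed
  hence "(\<Sum>x\<in>?F. chi (p ^ (2 * m)) (poly f x))
      \<ge> (\<Sum>x\<in>?F. 1 - (if x \<in> ?Z then 1 else 0) - 2 * (if x \<in> ?A then 1 else 0))"
    by (intro sum_mono) auto
  also have "(\<Sum>x\<in>?F. 1 - (if x \<in> ?Z then 1 else 0) - 2 * (if x \<in> ?A then 1 else 0))
      = real (card ?F) - real (card ?Z) - 2 * real (card ?A)"
    using fin by (simp add: sum_subtractf sum_distrib_left [symmetric] sum.If_cases Int_def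
                       flip: sum.inter_filter)
  finally have 1: "(\<Sum>x\<in>?F. chi (p ^ (2 * m)) (poly f x)) \<ge> real (card ?F) - real (card ?Z) - 2 * real (card ?A)" .
  have c1: "card ?F = B ^ 2" using card_Fq[of "2 * m"] assms q by simp
  \<comment> \<open>The zeros number at most 2e, which is absorbed into 2eB and raises the constant
    from 6e + 2 to 8e + 2.\<close>
  have c2: "card ?Z \<le> 2 * e"
    unfolding degree_f [symmetric]
    by (rule order_trans[OF card_mono[OF poly_roots_finite[OF fz]] card_poly_roots_bound[OF fz]]) auto
  have c3: "2 * e \<le> 2 * e * B" using p_power_pos[of m] by (simp add: B_def Suc_le_eq)
  have "card ?F + (8 * e + 2) * B \<ge> card ?Z + 2 * card ?A"
  proof -
    have "(8 * e + 2) * B = 2 * e * B + (6 * e + 2) * B" by (simp add: algebra_simps)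
    thus ?thesis using card_nonsquare_values c1 c2 c3 by linarith
  qed
  hence "real (card ?F + (8 * e + 2) * B) \<ge> real (card ?Z + 2 * card ?A)" by (simp only: of_nat_le_iff)
  thus ?thesis using 1 by simp
qed

end

subsection \<open>Bounding the character sums\<close>

context fp_closure
begin

section \<open>The Artin-Schreier map and its fibres\<close>

definition AS :: "'k poly" where
  "AS = monom 1 p - [:0, 1:]"

lemma poly_AS [simp]: "poly AS x = x ^ p - x"
  by (simp add: AS_def poly_monom)

lemma pderiv_AS: "pderiv AS = - 1"
proof -
  have "(of_nat p :: 'k) = 0" by (simp add: of_nat_eq_0_iff_char_dvd char_K)
  thus ?thesis by (simp add: AS_def pderiv_diff pderiv_monom pderiv_pCons one_pCons)
qed

lemma degree_AS: "degree AS = p"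
  using rsquarefree_Fq_poly(2)[of 1] by (simp add: AS_def)

lemma AS_Fpoly: "AS \<in> Fpoly"
  unfolding AS_def by (intro Fpoly_diff Fpoly_monom) (simp add: Fpoly_pCons)

lemma Tr_AS:
  assumes "u \<in> F n"
  shows "Tr n (u ^ p - u) = 0"
proof -
  have "Tr n (u ^ p - u) = (\<Sum>i<n. u ^ p ^ Suc i - u ^ p ^ i)"
    unfolding Tr_def frob_diff by (simp add: power_mult)
  also have "\<dots> = u ^ p ^ n - u ^ p ^ 0" by (rule sum_lessThan_telescope)
  finally show ?thesis using assms by (simp add: Fq_def)
qed

text \<open>The roots of \<open>X\<^sup>p - X - x\<close> lie in \<open>F n\<close> because \<open>u\<^sup>q - u = Tr x\<close> for such a root $u$.\<close>
lemma card_AS_fibre: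
  assumes "Tr n x = 0"
  shows "card {u \<in> F n. u ^ p - u = x} = p"
proof -
  let ?g = "AS - [:x:]"
  have roots: "{u \<in> F n. u ^ p - u = x} = {u. poly ?g u = 0}"
  proof -
    have "u \<in> F n" if "u ^ p - u = x" for u
    proof -
      have "Tr n x = (\<Sum>i<n. u ^ p ^ Suc i - u ^ p ^ i)"
        unfolding Tr_def that [symmetric] frob_diff by (simp add: power_mult)
      also have "\<dots> = u ^ p ^ n - u ^ p ^ 0" by (rule sum_lessThan_telescope)
      finally show ?thesis using assms by (simp add: Fq_def)
    qed
    thus ?thesis by auto
  qed
  have deg: "degree ?g = p"
    using degree_add_eq_left[of "- [:x:]" AS, unfolded add_uminus_conv_diff] degree_AS p_pos by simp
  have "rsquarefree ?g"
  proof (rule rsquarefreeI)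
    show "?g \<noteq> 0" using deg p_pos by (metis degree_0 less_irrefl)
  qed (simp add: pderiv_diff pderiv_AS)
  from card_roots_rsquarefree[OF this] show ?thesis unfolding roots deg .
qed

end

context kloosterman
begin

text \<open>Summing over all characters leaves only \<open>x\<close> of trace 0, with weight
  \<open>p\<close>. Each such \<open>x\<close> has exactly \<open>p\<close> preimages under u^p - u,
  which absorb the weight.\<close>

lemma sum_T:
  assumes n: "n > 0"
  shows "(\<Sum>a\<in>{0..<int p}. T a n) = of_real (\<Sum>u\<in>F n. chi (p ^ n) (poly (AS ^ 2 - [:d:]) u))"
proof -
  have fin: "finite (F n)" using finite_Fq[OF n] .
  have "(\<Sum>a\<in>{0..<int p}. T a n)
      = (\<Sum>x\<in>F n. (\<Sum>a\<in>{0..<int p}. psi a (Tr n x)) * of_real (chi (p ^ n) (x ^ 2 - d)))"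
    unfolding T_def by (subst sum.swap) (simp only: sum_distrib_right)
  also have "\<dots> = (\<Sum>x\<in>F n. if Tr n x = 0 then of_nat p * of_real (chi (p ^ n) (x ^ 2 - d)) else 0)"
    by (intro sum.cong refl) (simp add: sum_psi_chars Tr_in_Fp)
  also have "\<dots> = (\<Sum>x\<in>{x \<in> F n. Tr n x = 0}. of_nat p * of_real (chi (p ^ n) (x ^ 2 - d)))"
    by (rule sum.inter_filter [symmetric]) (rule fin)
  also have "\<dots> = (\<Sum>x\<in>{x \<in> F n. Tr n x = 0}. \<Sum>u\<in>{u \<in> F n. u ^ p - u = x}. of_real (chi (p ^ n) ((u ^ p - u) ^ 2 - d)))"
    by (intro sum.cong refl) (simp add: card_AS_fibre)
  also have "\<dots> = (\<Sum>u\<in>F n. of_real (chi (p ^ n) ((u ^ p - u) ^ 2 - d)))"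
  proof (rule sum.group)
    show "(\<lambda>u. u ^ p - u) ` F n \<subseteq> {x \<in> F n. Tr n x = 0}"
      by (auto simp: Tr_AS intro!: Fq_diff Fq_power)
  qed (use fin in auto)
  finally show ?thesis by simp
qed

lemma sum_T_lower_bound:
  assumes "m \<ge> 2"
  shows "Re (\<Sum>a\<in>{0..<int p}. T a (2 * m)) \<ge> - real ((8 * p + 2) * p ^ m)"
proof -
  let ?f = "AS ^ 2 - [:d:]"
  have deg: "degree ?f = 2 * p"
  proof -
    have "AS \<noteq> 0" using degree_AS p_pos by (metis degree_0 less_irrefl)
    hence "degree (AS ^ 2) = 2 * p" by (simp add: degree_power_eq degree_AS)
    thus ?thesis using degree_add_eq_left[of "- [:d:]" "AS ^ 2", unfolded add_uminus_conv_diff] p_pos by simp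
  qed
  define h where "h = (p ^ m + 1) div 2"
  have h: "2 * h = p ^ m + 1" unfolding h_def using odd_p_power[of m] by (intro dvd_mult_div_cancel) simp
  \<comment> \<open>Here e = p, so h > p is required; it follows from 2h = p^m + 1 and p^m \<ge> p^2
    \<ge> 3p, which is where m \<ge> 2 enters.\<close>
  have "p * 3 \<le> p * p" using p_gt_2 by simp
  also have "p * p = p ^ 2" by (simp add: power2_eq_square)
  also have "\<dots> \<le> p ^ m" using assms p_gt_2 by (intro power_increasing) auto
  finally have h_gt: "h > p" using h p_gt_2 by linarith
  interpret S: stepanov p K ?f p m "p ^ m" h
  proof unfold_locales
    show "?f \<in> Fpoly" using AS_Fpoly d_Fp by (intro Fpoly_diff Fpoly_power) (auto simp: Fpoly_pCons)
    show "poly ?f 0 \<noteq> 0" using d_nz p_gt_2 by (simp add: power_0_left)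
    show "rsquarefree ?f"
    proof (rule rsquarefreeI)
      show "?f \<noteq> 0" using deg p_pos by (metis degree_0 mult_is_0 less_irrefl zero_neq_numeral)
      fix x assume "poly ?f x = 0"
      hence *: "(x ^ p - x) ^ 2 = d" by simp
      \<comment> \<open>At a root the square of x^p - x is the nonzero \<open>d\<close>, so the
        derivative cannot vanish there.\<close>
      have "poly (pderiv ?f) x = - (2 * (x ^ p - x))"
        by (simp add: pderiv_diff power2_eq_square pderiv_mult pderiv_AS)
      moreover have "x ^ p - x \<noteq> 0" using * d_nz by (metis zero_power2)
      ultimately show "poly (pderiv ?f) x \<noteq> 0" using two_neq_0 by simp
    qed
  qed (use deg h h_gt p_pos in auto)
  have "(\<Sum>x\<in>F (2 * m). chi (p ^ (2 * m)) (poly ?f x)) \<ge> - real ((8 * p + 2) * p ^ m)"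
    by (rule S.sum_chi_lower_bound) (use assms in simp)
  thus ?thesis using sum_T[of "2 * m"] assms by simp
qed

section \<open>Power sums of the inverse roots of the L-function and the Weil bound\<close>

lemma T_0:
  assumes "n > 0"
  shows "T 0 n = - 1"
proof -
  have "d \<in> F n" using d_Fp Fp_subset by blast
  thus ?thesis unfolding T_def
    using sum_chi_hyperbola[OF assms _ d_nz] by (simp flip: of_real_sum)
qed

text \<open>\<alpha> and \<beta> are the inverse roots of 1 + Tz + pz^2; their power sums satisfy
  the same recurrence and initial values up to sign.\<close>

lemma T_power_sum:
  assumes a: "\<not> int p dvd a" and sum: "\<alpha> + \<beta> = - T a 1" and prod: "\<alpha> * \<beta> = of_nat p"
  shows "T a (Suc n) = - (\<alpha> ^ Suc n + \<beta> ^ Suc n)"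
proof (induction n rule: less_induct)
  case (less n)
  have T1: "T a 1 = - (\<alpha> + \<beta>)" using sum by simp
  consider "n = 0" | "n = 1" | k where "n = k + 2"
    by (metis One_nat_def add_2_eq_Suc' not0_implies_Suc)
  thus ?case
  proof cases
    case 1
    thus ?thesis using T1 by simp
  next
    case 2
    have "T a 2 = - (\<alpha> ^ 2 + \<beta> ^ 2)"
      unfolding T_2[OF a] T1 prod [symmetric] by (simp add: power2_eq_square algebra_simps)
    thus ?thesis using 2 by (simp add: numeral_2_eq_2)
  next
    case (3 k)
    have 1: "T a (k + 1) = - (\<alpha> ^ (k + 1) + \<beta> ^ (k + 1))" using less[of k] 3 by simp
    have 2: "T a (k + 2) = - (\<alpha> ^ (k + 2) + \<beta> ^ (k + 2))" using less[of "k + 1"] 3 by simp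
    have "T a (k + 3) = - (\<alpha> ^ (k + 3) + \<beta> ^ (k + 3))"
      unfolding T_rec[OF a] 1 2 T1 prod [symmetric] by (simp add: power_add power2_eq_square power3_eq_cube algebra_simps)
    thus ?thesis using 3 by (simp add: eval_nat_numeral)
  qed
qed

lemma T_of_Re: "T a n = of_real (Re (T a n))"
  using T_real[of a n] by simp

text \<open>The discriminant is not positive, so the inverse roots are complex conjugates of
  absolute value sqrt p.\<close>

lemma Re_T_small:
  assumes a: "\<not> int p dvd a" and small: "Re (T a 1) ^ 2 \<le> 4 * real p"
  shows "Re (T a (Suc n)) ^ 2 \<le> 4 * real p ^ Suc n"
proof -
  let ?l = "Re (T a 1)"
  define \<alpha> where "\<alpha> = Complex (- ?l / 2) (sqrt (4 * real p - ?l ^ 2) / 2)"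
  have "\<alpha> + cnj \<alpha> = - T a 1"
    by (subst T_of_Re) (simp add: \<alpha>_def complex_eq_iff)
  moreover have ac: "\<alpha> * cnj \<alpha> = of_nat p"
    using small by (simp add: \<alpha>_def complex_eq_iff power2_eq_square field_simps)
  ultimately have "T a (Suc n) = - (\<alpha> ^ Suc n + cnj \<alpha> ^ Suc n)"
    by (rule T_power_sum[OF a])
  hence "\<bar>Re (T a (Suc n))\<bar> \<le> norm (\<alpha> ^ Suc n) + norm (cnj \<alpha> ^ Suc n)"
    using abs_Re_le_cmod[of "T a (Suc n)"] norm_triangle_ineq[of "\<alpha> ^ Suc n" "cnj \<alpha> ^ Suc n"]
    by (simp only: norm_minus_cancel)
  hence "\<bar>Re (T a (Suc n))\<bar> \<le> 2 * norm \<alpha> ^ Suc n"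
    by (simp add: norm_mult norm_power)
  hence "Re (T a (Suc n)) ^ 2 \<le> (2 * norm \<alpha> ^ Suc n) ^ 2"
    by (simp only: abs_le_square_iff [symmetric])
  also have "\<dots> = 4 * (norm \<alpha> ^ 2) ^ Suc n"
    by (simp only: power_mult_distrib power_mult [symmetric] mult.commute[of _ 2]) simp
  also have "norm \<alpha> ^ 2 = real p"
    using ac by (metis complex_norm_square of_real_eq_iff of_real_of_nat_eq)
  finally show ?thesis .
qed

text \<open>The inverse roots are real with \<alpha>^2 + \<beta>^2 = T^2 - 2p > 2p, so one of the
  squares exceeds p. Even exponents prevent cancellation between the two powers.\<close>

lemma Re_T_large:
  assumes a: "\<not> int p dvd a" and large: "Re (T a 1) ^ 2 > 4 * real p"
  obtains x where "x > real p" "\<And>m. m > 0 \<Longrightarrow> Re (T a (2 * m)) \<le> - (x ^ m)"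
proof -
  let ?l = "Re (T a 1)"
  define r where "r = sqrt (?l ^ 2 - 4 * real p)"
  define \<alpha> where "\<alpha> = (- ?l + r) / 2"
  define \<beta> where "\<beta> = (- ?l - r) / 2"
  have r2: "r ^ 2 = ?l ^ 2 - 4 * real p" using large by (simp add: r_def)
  have sum_ab: "\<alpha> + \<beta> = - ?l" unfolding \<alpha>_def \<beta>_def by (simp only: add_divide_distrib [symmetric]) simp
  have "complex_of_real \<alpha> + complex_of_real \<beta> = - T a 1"
    by (subst T_of_Re) (simp only: sum_ab [symmetric] of_real_add of_real_minus [symmetric])
  moreover have ab: "\<alpha> * \<beta> = real p"
    using r2 by (simp add: \<alpha>_def \<beta>_def field_simps power2_eq_square)
  hence "complex_of_real \<alpha> * complex_of_real \<beta> = of_nat p"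
    by (metis of_real_mult of_real_of_nat_eq)
  ultimately have T: "T a (Suc n) = - (complex_of_real \<alpha> ^ Suc n + complex_of_real \<beta> ^ Suc n)" for n
    by (rule T_power_sum[OF a])
  have "\<alpha> ^ 2 + \<beta> ^ 2 = (\<alpha> + \<beta>) ^ 2 - 2 * (\<alpha> * \<beta>)"
    by (simp add: power2_eq_square algebra_simps)
  also note sum_ab
  finally have s: "\<alpha> ^ 2 + \<beta> ^ 2 > 2 * real p" using large ab by simp
  show thesis
  proof (rule that[of "max (\<alpha> ^ 2) (\<beta> ^ 2)"])
    show "max (\<alpha> ^ 2) (\<beta> ^ 2) > real p" using s by linarith
    fix m :: nat assume "m > 0"
    hence "T a (2 * m) = - (complex_of_real \<alpha> ^ (2 * m) + complex_of_real \<beta> ^ (2 * m))"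
      using T[of "2 * m - 1"] by simp
    hence "Re (T a (2 * m)) = - ((\<alpha> ^ 2) ^ m + (\<beta> ^ 2) ^ m)"
      by (simp add: power_mult flip: of_real_power of_real_add)
    moreover have "(max (\<alpha> ^ 2) (\<beta> ^ 2)) ^ m \<le> (\<alpha> ^ 2) ^ m + (\<beta> ^ 2) ^ m"
      by (simp add: max_def)
    ultimately show "Re (T a (2 * m)) \<le> - (max (\<alpha> ^ 2) (\<beta> ^ 2) ^ m)" by simp
  qed
qed

lemma Re_T_even_le:
  assumes a: "\<not> int p dvd a" and m: "m > 0"
  shows "Re (T a (2 * m)) \<le> 2 * real p ^ m"
proof (cases "Re (T a 1) ^ 2 \<le> 4 * real p")
  case True
  have "Re (T a (2 * m)) ^ 2 \<le> 4 * real p ^ (2 * m)"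
    using Re_T_small[OF a True, of "2 * m - 1"] m by simp
  also have "\<dots> = (2 * real p ^ m) ^ 2"
    by (simp add: power_mult_distrib mult.commute flip: power_mult)
  finally show ?thesis by (rule power2_le_imp_le) simp
next
  case False
  then obtain x where x: "x > real p" "Re (T a (2 * m)) \<le> - (x ^ m)"
    using Re_T_large[OF a] m by (metis not_le)
  have "- (x ^ m) \<le> 0" using x(1) by simp
  also have "0 \<le> 2 * real p ^ m" by simp
  finally show ?thesis using x(2) by linarith
qed

text \<open>If the bound failed for one character, its even sums would tend to minus infinity like
  -x^m with x > p. The remaining characters add at most O(p^m), contradicting the lower bound from
  Stepanov's method.\<close>

lemma norm_T_1_le:
  assumes a: "a \<in> {1..<int p}"
  shows "norm (T a 1) \<le> 2 * sqrt (real p)"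
proof -
  have nd: "\<not> int p dvd b" if "b \<in> {1..<int p}" for b
    using that zdvd_not_zless by auto
  have "Re (T a 1) ^ 2 \<le> 4 * real p"
  proof (rule ccontr)
    assume "\<not> Re (T a 1) ^ 2 \<le> 4 * real p"
    then obtain x where x: "x > real p" "\<And>m. m > 0 \<Longrightarrow> Re (T a (2 * m)) \<le> - (x ^ m)"
      using Re_T_large[OF nd[OF a]] by (metis not_le)
    \<comment> \<open>The constant 10p + 2 consists of 8p + 2 from the lower bound and 2p from the
      other nontrivial characters; the trivial one contributes -1.\<close>
    have bound: "(x / real p) ^ m \<le> real (10 * p + 2)" if m: "m \<ge> 2" for m
    proof -
      have split: "{0..<int p} = insert 0 (insert a ({1..<int p} - {a}))" using a by auto
      have "- real ((8 * p + 2) * p ^ m) \<le> (\<Sum>b\<in>{0..<int p}. Re (T b (2 * m)))"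
        using sum_T_lower_bound[OF m] by simp
      also have "\<dots> = Re (T 0 (2 * m)) + (Re (T a (2 * m)) + (\<Sum>b\<in>{1..<int p} - {a}. Re (T b (2 * m))))"
        by (subst split, subst sum.insert, simp, use a in simp, subst sum.insert) simp_all
      also have "\<dots> \<le> 0 + (- (x ^ m) + (\<Sum>b\<in>{1..<int p} - {a}. 2 * real p ^ m))"
        using T_0[of "2 * m"] m x(2)[of m]
        by (intro add_mono sum_mono Re_T_even_le nd) auto
      also have "(\<Sum>b\<in>{1..<int p} - {a}. 2 * real p ^ m) \<le> real p * (2 * real p ^ m)"
        using a by (simp add: card_Diff_singleton mult_right_mono)
      finally have "x ^ m \<le> real (10 * p + 2) * real p ^ m" by (simp add: algebra_simps)
      thus ?thesis using p_pos by (simp add: power_divide divide_le_eq)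
    qed
    have "x / real p > 1" using x(1) p_pos by simp
    then obtain n where n: "real (10 * p + 2) < (x / real p) ^ n"
      using real_arch_pow by blast
    also have "\<dots> \<le> (x / real p) ^ (n + 2)"
      using \<open>x / real p > 1\<close> by (intro power_increasing) auto
    finally show False using bound[of "n + 2"] by simp
  qed
  hence "\<bar>Re (T a 1)\<bar> ^ 2 \<le> (2 * sqrt (real p)) ^ 2" by (simp add: power_mult_distrib)
  hence "\<bar>Re (T a 1)\<bar> \<le> 2 * sqrt (real p)" by (rule power2_le_imp_le) simp
  thus ?thesis by (subst T_of_Re) simp
qed

end

subsection \<open>Exponential sums over the unit circle\<close>

context fp_closure
begin

section \<open>Circles over a prime field in which -1 is not a square\<close>

definition circle :: "'k \<Rightarrow> ('k \<times> 'k) set" where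
  "circle c = {(x, y) \<in> Fp \<times> Fp. x ^ 2 + y ^ 2 = c}"

text \<open>For p = 3 modulo 4 the exponent (p-1)/2 is odd, so -1 is a nonsquare.\<close>

lemma chi_uminus:
  assumes "p mod 4 = 3" "w \<in> Fp"
  shows "chi p (- w) = - chi p w"
proof -
  have "odd ((p - 1) div 2)" using assms(1) by presburger
  hence "(- 1 :: 'k) ^ ((p - 1) div 2) \<noteq> 1" using minus_one_neq_1 by simp
  hence "chi p (- 1) = - 1" by (simp add: chi_def)
  moreover have "chi p (- 1 * w) = chi p (- 1) * chi p w"
    using Fp_uminus[of 1] assms(2) by (intro chi_mult_p) auto
  ultimately show ?thesis by simp
qed

lemma sum_of_squares_nonzero:
  assumes "p mod 4 = 3" "x \<in> Fp" "y \<in> Fp" "x \<noteq> 0 \<or> y \<noteq> 0"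
  shows "x ^ 2 + y ^ 2 \<noteq> 0"
proof
  assume *: "x ^ 2 + y ^ 2 = 0"
  hence "x \<noteq> 0" "y \<noteq> 0" using assms(4) by auto
  hence "chi p (x ^ 2) = 1" "chi p (y ^ 2) = 1"
    using chi_square[of _ 1] assms by auto
  moreover have "x ^ 2 = - (y ^ 2)" using * by (simp add: eq_neg_iff_add_eq_0)
  ultimately show False using chi_uminus[OF assms(1), of "y ^ 2"] assms(3) by (simp add: Fq_power)
qed

text \<open>For given \<open>x\<close> the number of \<open>y\<close> is 1 + chi(c - x^2), and
  \<open>chi_uminus\<close> turns the plus sign into a minus sign.\<close>

lemma sum_circle:
  assumes "p mod 4 = 3" "c \<in> Fp"
  shows "(\<Sum>(x, y)\<in>circle c. g x) = (\<Sum>x\<in>Fp. g x * (1 - of_real (chi p (x ^ 2 - c))) :: complex)"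
proof -
  have eq: "circle c = (SIGMA x : Fp. {y \<in> Fp. y ^ 2 = c - x ^ 2})"
    by (auto simp: circle_def algebra_simps)
  have "(\<Sum>(x, y)\<in>circle c. g x) = (\<Sum>x\<in>Fp. \<Sum>y\<in>{y \<in> Fp. y ^ 2 = c - x ^ 2}. g x)"
    unfolding eq by (rule sum.Sigma [symmetric]) auto
  also have "\<dots> = (\<Sum>x\<in>Fp. g x * (1 - of_real (chi p (x ^ 2 - c))))"
  proof (intro sum.cong refl)
    fix x assume x: "x \<in> Fp"
    have Fp: "c - x ^ 2 \<in> Fp" "x ^ 2 - c \<in> Fp" using x assms(2) by (auto intro!: Fp_diff Fq_power)
    have "real (card {y \<in> Fp. y ^ 2 = c - x ^ 2}) = 1 + chi p (- (x ^ 2 - c))"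
      using card_square_roots[of 1 "c - x ^ 2"] Fp by simp
    hence "real (card {y \<in> Fp. y ^ 2 = c - x ^ 2}) = 1 - chi p (x ^ 2 - c)"
      by (simp only: chi_uminus[OF assms(1) Fp(2)])
    hence "complex_of_real (real (card {y \<in> Fp. y ^ 2 = c - x ^ 2})) = of_real (1 - chi p (x ^ 2 - c))"
      by (rule arg_cong)
    thus "(\<Sum>y\<in>{y \<in> Fp. y ^ 2 = c - x ^ 2}. g x) = g x * (1 - of_real (chi p (x ^ 2 - c)))"
      by simp
  qed
  finally show ?thesis .
qed

lemma card_circle:
  assumes "p mod 4 = 3"
  shows "card (circle 1) = p + 1"
proof -
  have "complex_of_nat (card (circle 1)) = (\<Sum>(x, y)\<in>circle 1. 1)" by (simp add: case_prod_unfold)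
  also have "\<dots> = (\<Sum>x\<in>Fp. 1 * (1 - of_real (chi p (x ^ 2 - 1))))"
    by (rule sum_circle[OF assms]) simp
  also have "\<dots> = of_nat p - of_real (\<Sum>x\<in>Fp. chi p (x ^ 2 - 1))"
    by (simp add: sum_subtractf card_Fp)
  also have "(\<Sum>x\<in>Fp. chi p (x ^ 2 - 1)) = - 1"
    using sum_chi_hyperbola[of 1 1] by simp
  finally have "complex_of_nat (card (circle 1)) = of_nat (p + 1)" by simp
  thus ?thesis by (simp only: of_nat_eq_iff)
qed

text \<open>The similarity \<open>(x, y) \<mapsto> (b x + c y, b y - c x)\<close> maps the unit circle onto
  \<open>circle (b\<^sup>2 + c\<^sup>2)\<close> and turns the linear form into the first coordinate.\<close>
lemma sum_circle_psi:
  assumes p: "p mod 4 = 3" and bc: "b \<in> Fp" "c \<in> Fp" "b \<noteq> 0 \<or> c \<noteq> 0"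
  shows "norm (\<Sum>(x, y)\<in>circle 1. psi 1 (b * x + c * y)) \<le> 2 * sqrt (real p)"
proof -
  define d where "d = b ^ 2 + c ^ 2"
  have d: "d \<noteq> 0" unfolding d_def by (rule sum_of_squares_nonzero[OF p bc])
  have dF: "d \<in> Fp" unfolding d_def by (intro Fp_add Fq_power bc)
  obtain s where s: "s ^ 2 = d" using nth_root_exists[of 2 d] by auto
  interpret kloosterman p K d s by unfold_locales (use d dF s in auto)
  have "bij_betw (\<lambda>(x, y). (b * x + c * y, b * y - c * x)) (circle 1) (circle d)"
  proof (rule bij_betw_byWitness[where f' = "\<lambda>(t, w). ((b * t - c * w) / d, (c * t + b * w) / d)"], goal_cases)
    case 1
    have "b * (b * x + c * y) - c * (b * y - c * x) = d * x" "c * (b * x + c * y) + b * (b * y - c * x) = d * y" for x y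
      by (simp_all add: d_def algebra_simps power2_eq_square)
    thus ?case using d by auto
  next
    case 2
    have "b * ((b * t - c * w) / d) + c * ((c * t + b * w) / d) = (d * t) / d"
         "b * ((c * t + b * w) / d) - c * ((b * t - c * w) / d) = (d * w) / d" for t w
      unfolding times_divide_eq_right add_divide_distrib [symmetric] diff_divide_distrib [symmetric]
      by (simp_all add: d_def algebra_simps power2_eq_square)
    thus ?case using d by auto
  next
    case 3
    have "(b * x + c * y) ^ 2 + (b * y - c * x) ^ 2 = d * (x ^ 2 + y ^ 2)" for x y
      by (simp add: d_def algebra_simps power2_eq_square)
    thus ?case using bc by (auto simp: circle_def intro!: Fp_add Fp_diff Fq_mult)
  next
    case 4
    have "((b * t - c * w) / d) ^ 2 + ((c * t + b * w) / d) ^ 2 = (d * (t ^ 2 + w ^ 2)) / (d * d)" for t w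
      unfolding power_divide add_divide_distrib [symmetric]
      by (simp add: d_def algebra_simps power2_eq_square)
    thus ?case using bc d dF by (auto simp: circle_def intro!: Fq_divide Fp_add Fp_diff Fq_mult)
  qed
  hence "(\<Sum>z\<in>circle 1. psi 1 (fst (case z of (x, y) \<Rightarrow> (b * x + c * y, b * y - c * x)))) = (\<Sum>z\<in>circle d. psi 1 (fst z))"
    by (rule sum.reindex_bij_betw)
  hence "(\<Sum>(x, y)\<in>circle 1. psi 1 (b * x + c * y)) = (\<Sum>(x, y)\<in>circle d. psi 1 x)"
    by (simp add: case_prod_unfold)
  also have "\<dots> = (\<Sum>x\<in>Fp. psi 1 x * (1 - of_real (chi p (x ^ 2 - d))))"
    by (rule sum_circle[OF p dF])
  also have "\<dots> = (\<Sum>x\<in>Fp. psi 1 x) - T 1 1"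
    by (simp add: T_def Tr_def sum_subtractf algebra_simps)
  also have "(\<Sum>x\<in>Fp. psi 1 x) = 0" using p_gt_2 by (simp add: sum_psi)
  finally show ?thesis using norm_T_1_le[of 1] p_gt_2 by simp
qed

lemma bij_units_circle:
  "bij_betw (\<lambda>(x, y). (of_int x, of_int y)) (gi_units (int p)) (circle 1)"
proof -
  let ?g = "\<lambda>(x, y). (of_int x :: 'k, of_int y :: 'k)"
  have inj: "inj_on (of_int :: int \<Rightarrow> 'k) {0..<int p}" and im: "of_int ` {0..<int p} = Fp"
    using bij_of_int by (auto simp: bij_betw_def)
  have eq: "gi_norm (int p) (x, y) = 1 mod int p \<longleftrightarrow> (of_int x ^ 2 + of_int y ^ 2 :: 'k) = 1" for x y
    using of_int_eq_iff_mod[of "x ^ 2 + y ^ 2" 1] by (simp add: gi_norm_def cong_def)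
  show ?thesis
    unfolding bij_betw_def
  proof (intro conjI equalityI subsetI)
    show "inj_on ?g (gi_units (int p))"
      using inj by (auto simp: inj_on_def gi_units_def gi_carrier_def)
    fix z assume "z \<in> ?g ` gi_units (int p)"
    thus "z \<in> circle 1" using eq by (auto simp: circle_def gi_units_def)
  next
    fix z :: "'k \<times> 'k" assume z: "z \<in> circle 1"
    then obtain x y where xy: "x \<in> {0..<int p}" "y \<in> {0..<int p}" "z = (of_int x, of_int y)"
      unfolding circle_def im [symmetric] by auto
    hence "(x, y) \<in> gi_units (int p)"
      using z eq by (auto simp: circle_def gi_units_def gi_carrier_def)
    thus "z \<in> ?g ` gi_units (int p)" using xy(3) by force
  qed
qed

end

text \<open>Phrased with integers only, without the type \<open>'k\<close>, so that the result can
  leave the locale and be quantified over \<open>p\<close>.\<close>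

definition unit_sums_bounded :: "nat \<Rightarrow> bool" where
  "unit_sums_bounded p \<longleftrightarrow> card (gi_units (int p)) = p + 1 \<and>
     (\<forall>b\<in>gi_carrier (int p) - {(0, 0)}.
        norm (\<Sum>z\<in>gi_units (int p). ec p (fst b * fst z + snd b * snd z)) \<le> 2 * sqrt (real p))"

lemma (in fp_closure) unit_sums_bounded:
  assumes "p mod 4 = 3"
  shows "unit_sums_bounded p"
  unfolding unit_sums_bounded_def
proof (intro conjI ballI)
  show "card (gi_units (int p)) = p + 1"
    using bij_betw_same_card[OF bij_units_circle] card_circle[OF assms] by simp
  fix b assume b: "b \<in> gi_carrier (int p) - {(0, 0)}"
  have nz: "(of_int i :: 'k) \<noteq> 0" if "i \<in> {0..<int p}" "i \<noteq> 0" for i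
    using of_int_eq_iff_mod[of i 0] that by (simp add: cong_def)
  have "(\<Sum>z\<in>gi_units (int p). ec p (fst b * fst z + snd b * snd z))
      = (\<Sum>z\<in>gi_units (int p). (\<lambda>(x, y). psi 1 (of_int (fst b) * x + of_int (snd b) * y)) ((\<lambda>(x, y). (of_int x, of_int y)) z))"
    by (intro sum.cong refl)
       (simp add: case_prod_unfold psi_of_int flip: of_int_mult of_int_add)
  also have "\<dots> = (\<Sum>(x, y)\<in>circle 1. psi 1 (of_int (fst b) * x + of_int (snd b) * y))"
    by (rule sum.reindex_bij_betw[OF bij_units_circle])
  finally show "norm (\<Sum>z\<in>gi_units (int p). ec p (fst b * fst z + snd b * snd z)) \<le> 2 * sqrt (real p)"
    using sum_circle_psi[OF assms, of "of_int (fst b)" "of_int (snd b)"] b nz[of "fst b"] nz[of "snd b"]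
    by (cases b) (auto simp: gi_carrier_def)
qed

text \<open>A type cannot depend on the variable $p$, so the field with $p$ elements is only
  constructed for one fixed prime: a counterexample to the bound, if there is any.\<close>

definition critical_prime :: nat where
  "critical_prime = (SOME p. prime p \<and> p mod 4 = 3 \<and>
     ((\<exists>q. prime q \<and> q mod 4 = 3 \<and> \<not> unit_sums_bounded q) \<longrightarrow> \<not> unit_sums_bounded p))"

lemma critical_prime:
  "prime critical_prime" "critical_prime mod 4 = 3"
  "prime q \<Longrightarrow> q mod 4 = 3 \<Longrightarrow> unit_sums_bounded critical_prime \<Longrightarrow> unit_sums_bounded q"
proof -
  \<comment> \<open>If no counterexample exists, the prime 3 still shows that the choice is well
    defined.\<close>
  have "prime (3 :: nat)" "(3 :: nat) mod 4 = 3" by simp_all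
  hence "\<exists>p. prime p \<and> p mod 4 = 3 \<and>
     ((\<exists>q. prime q \<and> q mod 4 = 3 \<and> \<not> unit_sums_bounded q) \<longrightarrow> \<not> unit_sums_bounded p)"
    by blast
  from someI_ex[OF this, folded critical_prime_def]
  show "prime critical_prime" "critical_prime mod 4 = 3"
    "prime q \<Longrightarrow> q mod 4 = 3 \<Longrightarrow> unit_sums_bounded critical_prime \<Longrightarrow> unit_sums_bounded q"
    by blast+
qed

typedef critical_index = "{0..<critical_prime}"
  using prime_gt_0_nat[OF critical_prime(1)] by (intro exI[of _ 0]) simp

lemma card_critical_index: "CARD(critical_index) = critical_prime"
  using type_definition.card[OF type_definition_critical_index] by simp

instance critical_index :: prime_card
  by standard (simp add: card_critical_index critical_prime)

lemma unit_sums_bounded: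
  assumes "prime p" "p mod 4 = 3"
  shows "unit_sums_bounded p"
proof -
  interpret fp_closure critical_prime "TYPE(critical_index mod_ring alg_closure)"
  proof
    show "critical_prime > 2"
      using critical_prime(1,2) prime_ge_2_nat[of critical_prime] by (cases "critical_prime = 2") auto
    \<comment> \<open>The characteristic divides a prime and is not 1, hence equals it.\<close>
    have "CHAR(critical_index mod_ring) dvd critical_prime"
      using CHAR_dvd_CARD[where ?'a = "critical_index mod_ring"] by (simp add: card_critical_index)
    thus "CHAR(critical_index mod_ring alg_closure) = critical_prime"
      using critical_prime(1) CHAR_not_1'[where ?'a = "critical_index mod_ring"]
      by (auto simp: prime_nat_iff)
  qed (rule critical_prime)
  show ?thesis
    using unit_sums_bounded critical_prime(2,3) assms by blast
qed

subsection \<open>The Cayley graph\<close>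

locale unit_graph =
  fixes p :: nat
  assumes p_gt_2: "p > 2" and bounded: "unit_sums_bounded p"
begin

abbreviation "V \<equiv> gi_carrier (int p)"
abbreviation "U \<equiv> gi_units (int p)"
abbreviation "E \<equiv> gi_cayley_adj (int p) U"

section \<open>Fourier analysis on the additive group and the spectrum of the graph\<close>

definition shift :: "int \<times> int \<Rightarrow> int \<times> int \<Rightarrow> int \<times> int" where
  "shift v z = ((fst v + fst z) mod int p, (snd v + snd z) mod int p)"

definition dot :: "int \<times> int \<Rightarrow> int \<times> int \<Rightarrow> int" where
  "dot b z = fst b * fst z + snd b * snd z"

definition hat :: "(int \<times> int \<Rightarrow> complex) \<Rightarrow> int \<times> int \<Rightarrow> complex" where
  "hat f b = (\<Sum>v\<in>V. f v * ec p (dot b v))"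

text \<open>The adjacency eigenvalue attached to the frequency \<open>b\<close>; the minus sign
  comes from moving a translation from the function to the character.\<close>

definition eig :: "int \<times> int \<Rightarrow> complex" where
  "eig b = (\<Sum>z\<in>U. ec p (- dot b z))"

lemma p_pos: "p > 0"
  using p_gt_2 by simp

lemma finite_V [simp]: "finite V"
  by (simp add: gi_carrier_def)

lemma U_subset: "U \<subseteq> V"
  by (auto simp: gi_units_def)

lemma card_U: "card U = p + 1"
  using bounded by (simp add: unit_sums_bounded_def)

lemma norm_eig_le:
  assumes "b \<in> V" "b \<noteq> (0, 0)"
  shows "norm (eig b) \<le> 2 * sqrt (real p)"
proof -
  have "eig b = cnj (\<Sum>z\<in>U. ec p (fst b * fst z + snd b * snd z))"
    by (simp add: eig_def dot_def cnj_ec)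
  hence "norm (eig b) = norm (\<Sum>z\<in>U. ec p (fst b * fst z + snd b * snd z))"
    by (simp only: complex_mod_cnj)
  thus ?thesis using bounded assms by (simp add: unit_sums_bounded_def)
qed

lemma eig_0: "eig (0, 0) = of_nat (p + 1)"
  by (simp add: eig_def dot_def card_U)

lemma shift_in_V: "shift v z \<in> V"
  using p_pos by (simp add: shift_def gi_carrier_def)

lemma gi_diff_shift:
  assumes "z \<in> V"
  shows "gi_diff (int p) (shift v z) v = z"
  using assms by (cases z) (auto simp: gi_diff_def shift_def gi_carrier_def mod_simps)

lemma shift_gi_diff:
  assumes "u \<in> V"
  shows "shift v (gi_diff (int p) u v) = u"
  using assms by (cases u) (auto simp: gi_diff_def shift_def gi_carrier_def mod_simps)

lemma bij_nbrs: "bij_betw (shift v) U (nbrs V E v)"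
  unfolding bij_betw_def
proof (intro conjI equalityI subsetI)
  show "inj_on (shift v) U"
    by (rule inj_on_inverseI[where g = "\<lambda>u. gi_diff (int p) u v"]) (use gi_diff_shift U_subset in blast)
next
  fix u assume "u \<in> shift v ` U"
  then obtain z where "z \<in> U" "u = shift v z" by auto
  thus "u \<in> nbrs V E v"
    using gi_diff_shift[of z v] U_subset by (auto simp: nbrs_def gi_cayley_adj_def shift_in_V)
next
  fix u assume "u \<in> nbrs V E v"
  hence "u \<in> V" "gi_diff (int p) u v \<in> U" by (auto simp: nbrs_def gi_cayley_adj_def)
  thus "u \<in> shift v ` U" using shift_gi_diff[of u v] by (metis imageI)
qed

lemma regular: "regular_graph V E (p + 1)"
  unfolding regular_graph_def using bij_betw_same_card[OF bij_nbrs] card_U by metis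

lemma bij_shift: "bij_betw (\<lambda>v. shift v z) V V"
proof (rule bij_betw_byWitness[where f' = "\<lambda>u. gi_diff (int p) u z"])
  show "\<forall>v\<in>V. gi_diff (int p) (shift v z) z = v" "\<forall>u\<in>V. shift (gi_diff (int p) u z) z = u"
    by (auto simp: gi_diff_def shift_def gi_carrier_def mod_simps)
qed (use p_pos in \<open>auto simp: gi_diff_def shift_def gi_carrier_def\<close>)

lemma ec_dot_shift: "ec p (dot b (shift v z)) = ec p (dot b v) * ec p (dot b z)"
proof -
  have "[dot b (shift v z) = fst b * (fst v + fst z) + snd b * (snd v + snd z)] (mod int p)"
    unfolding dot_def shift_def fst_conv snd_conv
    by (intro cong_add cong_mult cong_refl) (simp_all add: cong_def)
  also have "fst b * (fst v + fst z) + snd b * (snd v + snd z) = dot b v + dot b z"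
    by (simp add: dot_def algebra_simps)
  finally have "[dot b (shift v z) = dot b v + dot b z] (mod int p)" .
  hence "ec p (dot b (shift v z)) = ec p (dot b v + dot b z)"
    by (intro ec_cong p_pos)
  thus ?thesis by (simp add: ec_add)
qed

text \<open>The adjacency operator is a sum of translations by units, and the Fourier transform
  turns each translation into multiplication by a character value.\<close>

lemma hat_adjacency: "(\<Sum>v\<in>V. (\<Sum>u\<in>nbrs V E v. f u) * ec p (dot b v)) = eig b * hat f b"
proof -
  have "(\<Sum>v\<in>V. (\<Sum>u\<in>nbrs V E v. f u) * ec p (dot b v))
      = (\<Sum>v\<in>V. \<Sum>z\<in>U. f (shift v z) * ec p (dot b v))"
    by (simp add: sum.reindex_bij_betw[OF bij_nbrs, symmetric] sum_distrib_right)
  also have "\<dots> = (\<Sum>z\<in>U. \<Sum>v\<in>V. f (shift v z) * ec p (dot b v))"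
    by (rule sum.swap)
  also have "\<dots> = (\<Sum>z\<in>U. ec p (- dot b z) * hat f b)"
  proof (intro sum.cong refl)
    fix z
    have "ec p (dot b z) * ec p (- dot b z) = 1" by (simp flip: ec_add)
    hence "(\<Sum>v\<in>V. f (shift v z) * ec p (dot b v))
        = ec p (- dot b z) * (\<Sum>v\<in>V. f (shift v z) * ec p (dot b (shift v z)))"
      unfolding ec_dot_shift sum_distrib_left by (intro sum.cong refl) (simp add: mult_ac)
    also have "(\<Sum>v\<in>V. f (shift v z) * ec p (dot b (shift v z))) = hat f b"
      unfolding hat_def by (rule sum.reindex_bij_betw[OF bij_shift])
    finally show "(\<Sum>v\<in>V. f (shift v z) * ec p (dot b v)) = ec p (- dot b z) * hat f b" .
  qed
  finally show ?thesis by (simp add: eig_def sum_distrib_right)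
qed

lemma hat_eigenfunction:
  assumes "\<And>v. v \<in> V \<Longrightarrow> (\<Sum>u\<in>nbrs V E v. f u) = \<mu> * f v"
  shows "\<mu> * hat f b = eig b * hat f b"
proof -
  have "\<mu> * hat f b = (\<Sum>v\<in>V. (\<Sum>u\<in>nbrs V E v. f u) * ec p (dot b v))"
    unfolding hat_def sum_distrib_left using assms by (intro sum.cong refl) (simp add: mult_ac)
  thus ?thesis by (simp only: hat_adjacency)
qed

lemma hat_inversion:
  assumes w: "w \<in> V"
  shows "(\<Sum>b\<in>V. hat f b * ec p (- dot b w)) = of_nat (p ^ 2) * f w"
proof -
  have inner: "(\<Sum>b\<in>V. ec p (dot b v - dot b w)) = (if v = w then of_nat (p ^ 2) else 0)" if v: "v \<in> V" for v
  proof -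
    have "(\<Sum>b\<in>V. ec p (dot b v - dot b w))
        = (\<Sum>b\<in>{0..<int p}. \<Sum>c\<in>{0..<int p}. ec p ((fst v - fst w) * b) * ec p ((snd v - snd w) * c))"
      unfolding gi_carrier_def sum.cartesian_product
      by (intro sum.cong refl) (auto simp: dot_def algebra_simps simp flip: ec_add)
    also have "\<dots> = (\<Sum>b\<in>{0..<int p}. ec p ((fst v - fst w) * b)) * (\<Sum>c\<in>{0..<int p}. ec p ((snd v - snd w) * c))"
      by (rule sum_product [symmetric])
    also have "\<dots> = (if int p dvd fst v - fst w \<and> int p dvd snd v - snd w then of_nat (p ^ 2) else 0)"
      by (simp add: sum_ec p_pos power2_eq_square)
    also have "int p dvd fst v - fst w \<and> int p dvd snd v - snd w \<longleftrightarrow> v = w"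
    proof -
      have "int p dvd i - j \<longleftrightarrow> i = j" if "i \<in> {0..<int p}" "j \<in> {0..<int p}" for i j
        using that by (simp add: mod_eq_dvd_iff [symmetric])
      thus ?thesis using v w by (cases v; cases w) (auto simp: gi_carrier_def)
    qed
    finally show ?thesis .
  qed
  have "(\<Sum>b\<in>V. hat f b * ec p (- dot b w)) = (\<Sum>b\<in>V. \<Sum>v\<in>V. f v * ec p (dot b v - dot b w))"
    by (simp add: hat_def sum_distrib_right mult.assoc flip: ec_add)
  also have "\<dots> = (\<Sum>v\<in>V. \<Sum>b\<in>V. f v * ec p (dot b v - dot b w))" by (rule sum.swap)
  also have "\<dots> = (\<Sum>v\<in>V. if v = w then of_nat (p ^ 2) * f v else 0)"
    by (intro sum.cong refl) (simp add: inner flip: sum_distrib_left)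
  also have "\<dots> = of_nat (p ^ 2) * f w" using w by simp
  finally show ?thesis .
qed

lemma adjacency_sym:
  assumes "u \<in> V" "v \<in> V" "E u v"
  shows "E v u"
proof -
  have norm: "gi_norm (int p) (gi_diff (int p) x y) = ((fst x - fst y) ^ 2 + (snd x - snd y) ^ 2) mod int p" for x y
    unfolding gi_norm_def gi_diff_def fst_conv snd_conv
    by (rule cong_add[OF cong_pow cong_pow, unfolded cong_def]) simp_all
  have "gi_norm (int p) (gi_diff (int p) u v) = gi_norm (int p) (gi_diff (int p) v u)"
    unfolding norm by (simp add: power2_commute)
  thus ?thesis using assms p_pos
    by (auto simp: gi_cayley_adj_def gi_units_def gi_carrier_def gi_diff_def)
qed

lemma spectral_gap: "2 * sqrt (real p) < real (p + 1)"
proof -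
  have "sqrt (real p) \<noteq> 1" using p_gt_2 by simp
  hence "(sqrt (real p) - 1) ^ 2 > 0" by simp
  thus ?thesis by (simp add: power2_eq_square algebra_simps)
qed

text \<open>The indicator function of a connected component is an eigenfunction for the eigenvalue
  $p + 1$, so by the spectral gap only its trivial Fourier coefficient is nonzero.\<close>
lemma connected: "connected_graph V E"
  unfolding connected_graph_def
proof (intro conjI ballI)
  show "V \<noteq> {}" using p_pos by (auto simp: gi_carrier_def)
  fix u v assume u: "u \<in> V" and v: "v \<in> V"
  let ?R = "\<lambda>x y. x \<in> V \<and> y \<in> V \<and> E x y"
  define f :: "int \<times> int \<Rightarrow> complex" where "f x = (if ?R\<^sup>*\<^sup>* u x then 1 else 0)" for x
  have eigf: "(\<Sum>y\<in>nbrs V E x. f y) = of_nat (p + 1) * f x" if x: "x \<in> V" for x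
  proof -
    have "f y = f x" if "y \<in> nbrs V E x" for y
    proof -
      have "?R x y" "?R y x" using that x adjacency_sym by (auto simp: nbrs_def)
      thus ?thesis unfolding f_def by (metis (mono_tags, lifting) rtranclp.rtrancl_into_rtrancl)
    qed
    hence "(\<Sum>y\<in>nbrs V E x. f y) = of_nat (card (nbrs V E x)) * f x" by simp
    thus ?thesis using regular x by (simp add: regular_graph_def)
  qed
  have hat0: "hat f b = 0" if "b \<in> V" "b \<noteq> (0, 0)" for b
  proof (rule ccontr)
    assume "hat f b \<noteq> 0"
    hence "of_nat (p + 1) = eig b" using hat_eigenfunction[OF eigf, of b] by simp
    hence "norm (eig b) = real (p + 1)" by (metis norm_of_nat)
    thus False using norm_eig_le[OF that] spectral_gap by linarith
  qed
  have const: "of_nat (p ^ 2) * f w = hat f (0, 0)" if "w \<in> V" for w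
  proof -
    have "(\<Sum>b\<in>V. hat f b * ec p (- dot b w)) = (\<Sum>b\<in>{(0, 0)}. hat f b * ec p (- dot b w))"
      using hat0 p_pos by (intro sum.mono_neutral_right) (auto simp: gi_carrier_def)
    thus ?thesis using hat_inversion[OF that, of f] by (simp add: dot_def)
  qed
  have "of_nat (p ^ 2) * f u = of_nat (p ^ 2) * f v" using const[OF u] const[OF v] by simp
  hence "f u = f v" using p_pos by simp
  moreover have "f u = 1" by (simp add: f_def)
  ultimately show "?R\<^sup>*\<^sup>* u v" by (simp add: f_def split: if_splits)
qed

text \<open>By Fourier inversion an eigenfunction has a nonzero coefficient at some
  \<open>b\<close>, which forces \<open>\<mu> = eig b\<close>. The exclusion of p + 1 rules out
  \<open>b = (0, 0)\<close>, and k - 1 = p matches the bound on unit sums.\<close>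

lemma is_ramanujan: "ramanujan V E (p + 1)"
  unfolding ramanujan_def
proof (intro conjI allI impI)
  fix \<mu> assume *: "adj_eigenvalue V E \<mu> \<and> \<mu> \<noteq> of_nat (p + 1) \<and> \<mu> \<noteq> - of_nat (p + 1)"
  then obtain f v where f: "v \<in> V" "f v \<noteq> 0" "\<And>v. v \<in> V \<Longrightarrow> (\<Sum>u\<in>nbrs V E v. f u) = \<mu> * f v"
    by (auto simp: adj_eigenvalue_def)
  obtain b where b: "b \<in> V" "hat f b \<noteq> 0"
  proof (rule ccontr)
    assume "\<not> thesis"
    hence "\<And>b. b \<in> V \<Longrightarrow> hat f b = 0" using that by blast
    hence "of_nat (p ^ 2) * f v = 0" using hat_inversion[OF f(1), of f] by simp
    thus False using f(2) p_pos by simp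
  qed
  have "\<mu> = eig b" using hat_eigenfunction[OF f(3), of b] b(2) by simp
  moreover from this have "b \<noteq> (0, 0)" using * eig_0 by auto
  ultimately show "cmod \<mu> \<le> 2 * sqrt (real (p + 1) - 1)" using norm_eig_le[OF b(1)] by simp
qed (use regular connected in auto)

end

theorem theorem6:
  fixes p :: nat
  assumes "prime p" and "p mod 4 = 3"
  shows "regular_graph (gi_carrier (int p)) (gi_cayley_adj (int p) (gi_units (int p))) (p + 1)
       \<and> ramanujan (gi_carrier (int p)) (gi_cayley_adj (int p) (gi_units (int p))) (p + 1)"
proof -
  have "p > 2" using assms by (cases "p = 2") (auto simp: order.strict_iff_order dest: prime_ge_2_nat)
  then interpret unit_graph p
    by unfold_locales (use unit_sums_bounded[OF assms] in auto)
  show ?thesis using regular is_ramanujan by blast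
qed

end
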